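(* Let $d\ge2$ and let $\mu$ be a centered probability measure on $\mathbb{X}=\mathbb{R}^d$ such that $X\sim\mu$ satisfies $\|X\|_{\psi_2}<+\infty$. Let $\lambda_1\ge\lambda_2\ge\dots\ge\lambda_d$ be the eigenvalues of $\mathrm{Cov}(\mu)=\mathbb{E}[XX^T]$ and assume $\lambda_1>\lambda_2$. Let $\mathcal M=\mathbb{S}^{d-1}$ with the great circle distance $\vartheta(\phi,\psi)=\arccos\langle\phi,\psi\rangle$, $l(\phi,x)=-\langle\phi,x\rangle^2$ and $\mathcal R=0$. Then the assumptions (A1)–(A5) listed in the context are satisfied with $$\mathcal J_0=+\infty,\quad\beta=2,\quad\tau=\frac4{\pi^2}(\lambda_1-\lambda_2),\quad\alpha=1,\quad\eta=0,\quad\kappa(n)=2d\exp(-cn),\quad\iota=0,$$ $$a(x,y)=2\left(\|x\|_2^2+\|y\|_2^2\right)\mathbf 1_{x\ne y},\qquad\|a\|_{\psi_1}\le4d\|X\|_{\psi_2}^2,$$ where $$c=\frac{(\lambda_1-\lambda_2)^2}{32e^2(d+1)^2\|X\|_{\psi_2}^4+8e(d+1)\|X\|_{\psi_2}^2(\lambda_1-\lambda_2)}.$$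
   Context: For a real random variable $Z$ and $q\ge1$, $\|Z\|_{\psi_q}=\inf\{c>0:\mathbb{E}\exp(|Z|^q/c^q)\le2\}$; for a random vector $X\in\mathbb{R}^d$, $\|X\|_{\psi_2}=\sup_{v\in\mathbb{S}^{d-1}}\|\langle X,v\rangle\|_{\psi_2}$. Notation. The risk is $\mathcal J(\phi)=\mathbb{E}_{X\sim\mu}[l(\phi,X)]+\mathcal R(\phi)$; for $\mathbf{x}\in\mathbb{X}^n$ the empirical risk is $\widehat{\mathcal J}_{\mathbf x}(\phi)=\frac1n\sum_{i=1}^nl(\phi,x_i)+\mathcal R(\phi)$. $\mathcal S=\arg\min\mathcal J$, $\mathcal J_*=\min\mathcal J$, $\widehat{\mathcal S}_{\mathbf x}=\arg\min\widehat{\mathcal J}_{\mathbf x}$, $\widehat{\mathcal J}_{\mathbf x,*}=\min\widehat{\mathcal J}_{\mathbf x}$. $\vartheta(\phi,E)=\inf_{\psi\in E}\vartheta(\phi,\psi)$; $[\mathcal J\le c]=\{\phi:\mathcal J(\phi)\le c\}$. For a pseudometric $a$ on $\mathbb{X}$ (metric axioms except $a(x,y)=0\Rightarrow x=y$), $\|a\|_{\psi_1}:=\|a(X,Y)\|_{\psi_1}$ with $X,Y\sim\mu$ independent. $\mathbf{X}=(X_1,\dots,X_n)$ has i.i.d. components of law $\mu$. Bounds on probabilities are understood as capped at $1$. Assumptions. (A1) $\mathcal J$ is proper and has at least one minimizer; for all $n\ge1$ and $\mu^n$-almost every $\mathbf{x}$, $\widehat{\mathcal J}_{\mathbf x}$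 is proper with at least one minimizer, and its minimizers are measurable functions of $\mathbf{x}$ (the measurability is taken for granted). (A2) $\mathcal J_0\in(\mathcal J_*,+\infty]$, $\beta\ge1$, $\tau>0$, and $\phi\in[\mathcal J\le\mathcal J_0]$ implies $\tau\,\vartheta(\phi,\mathcal S)^\beta\le\mathcal J(\phi)-\mathcal J_*$. (A3) $\eta:\mathbb{N}\to[0,1]$, $\lim_n\eta(n)=0$ and $\mathbb{P}(\sup_{\widehat\phi\in\widehat{\mathcal S}_{\mathbf X}}\mathcal J(\widehat\phi)>\mathcal J_0)\le\eta(n)$. (A4) With $\widehat\tau_{\mathbf x}=\inf_{\mathbf y\in\mathrm{supp}(\mu)^n}\inf\left\{\frac{\widehat{\mathcal J}_{\mathbf x}(\phi)-\widehat{\mathcal J}_{\mathbf x,*}}{\vartheta(\phi,\widehat{\mathcal S}_{\mathbf x})^\beta}:\phi\in[\mathcal J\le\mathcal J_0]\cap\widehat{\mathcal S}_{\mathbf y}\right\}$ (points with $\vartheta(\phi,\widehat{\mathcal S}_{\mathbf x})=0$ disregarded), $\kappa:\mathbb{N}\to[0,1]$, $\lim_n\kappa(n)=0$ and $\mathbb{P}(\widehat\tau_{\mathbf X}<\tau/2)\le\kappa(n)$. (A5) $\alpha>0$, $a$ is a pseudometric on $\mathbb{X}$ with $\|a\|_{\psi_1}<\infty$, and there is $\Upsilon\subseteq\mathcal M$ with $\mathcal S\subseteq\Upsilon$ such that for all $\phi,\psi\in\Upsilon$ and $\mu$-almost every $x,y$, $l(\phi,x)-l(\psi,x)-l(\phi,y)+l(\psi,y)\le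 a(x,y)\,\vartheta(\phi,\psi)^\alpha$; moreover $\iota:\mathbb{N}\to[0,1]$, $\lim_n\iota(n)=0$ and $\mathbb{P}(\widehat{\mathcal S}_{\mathbf X}\not\subset\Upsilon)\le\iota(n)$. *)

theory Defs
  imports "HOL-Probability.Probability"
begin

subsection \<open>Orlicz norms\<close>

text \<open>Norms take values in \<^typ>\<open>ennreal\<close>, so that the infimum is \<open>\<infinity>\<close> when no
  constant is admissible.\<close>

definition psi_norm :: "real \<Rightarrow> 'a measure \<Rightarrow> ('a \<Rightarrow> real) \<Rightarrow> ennreal" where
  "psi_norm q M Z =
     Inf {ennreal c | c. 0 < c \<and>
            (\<integral>\<^sup>+ \<omega>. ennreal (exp (\<bar>Z \<omega>\<bar> powr q / c powr q)) \<partial>M) \<le> 2}"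

text \<open>The norm of a random vector depends only on its law \<open>\<mu>\<close>.\<close>

definition vec_psi2_norm :: "'a::euclidean_space measure \<Rightarrow> ennreal" where
  "vec_psi2_norm \<mu> = (SUP v \<in> sphere 0 1. psi_norm 2 \<mu> (\<lambda>x. x \<bullet> v))"

subsection \<open>Penalized empirical risk minimization\<close>

record ('m, 'x) erm_problem =
  hyps :: "'m set"
  metr :: "'m \<Rightarrow> 'm \<Rightarrow> real"
  loss :: "'m \<Rightarrow> 'x \<Rightarrow> real"
  penalty :: "'m \<Rightarrow> ereal"
  law :: "'x measure"

text \<open>The expectation as a difference of positive and negative parts, so that a
  non-integrable function is not silently given expectation \<open>0\<close>.\<close>

definition expect :: "'a measure \<Rightarrow> ('a \<Rightarrow> real) \<Rightarrow> ereal" where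
  "expect M f = enn2ereal (\<integral>\<^sup>+ x. ennreal (f x) \<partial>M) - enn2ereal (\<integral>\<^sup>+ x. ennreal (- f x) \<partial>M)"

definition risk :: "('m, 'x) erm_problem \<Rightarrow> 'm \<Rightarrow> ereal" where
  "risk P \<phi> = expect (law P) (loss P \<phi>) + penalty P \<phi>"

text \<open>A sample of size \<open>n\<close> is a function on \<open>{..<n}\<close>; its law is the \<open>n\<close>-fold product measure.\<close>

definition sample :: "('m, 'x) erm_problem \<Rightarrow> nat \<Rightarrow> (nat \<Rightarrow> 'x) measure" where
  "sample P n = Pi\<^sub>M {..<n} (\<lambda>_. law P)"

definition emp_risk :: "('m, 'x) erm_problem \<Rightarrow> nat \<Rightarrow> (nat \<Rightarrow> 'x) \<Rightarrow> 'm \<Rightarrow> ereal" where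
  "emp_risk P n x \<phi> = ereal ((\<Sum>i<n. loss P \<phi> (x i)) / real n) + penalty P \<phi>"

definition argmin_on :: "'m set \<Rightarrow> ('m \<Rightarrow> ereal) \<Rightarrow> 'm set" where
  "argmin_on M f = {\<phi> \<in> M. \<forall>\<psi>\<in>M. f \<phi> \<le> f \<psi>}"

definition proper_on :: "'m set \<Rightarrow> ('m \<Rightarrow> ereal) \<Rightarrow> bool" where
  "proper_on M f \<longleftrightarrow> (\<forall>\<phi>\<in>M. f \<phi> > -\<infinity>) \<and> (\<exists>\<phi>\<in>M. f \<phi> < \<infinity>)"

definition sols :: "('m, 'x) erm_problem \<Rightarrow> 'm set" where
  "sols P = argmin_on (hyps P) (risk P)"

definition min_risk :: "('m, 'x) erm_problem \<Rightarrow> ereal" where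
  "min_risk P = (INF \<phi> \<in> hyps P. risk P \<phi>)"

definition emp_sols :: "('m, 'x) erm_problem \<Rightarrow> nat \<Rightarrow> (nat \<Rightarrow> 'x) \<Rightarrow> 'm set" where
  "emp_sols P n x = argmin_on (hyps P) (emp_risk P n x)"

definition emp_min_risk :: "('m, 'x) erm_problem \<Rightarrow> nat \<Rightarrow> (nat \<Rightarrow> 'x) \<Rightarrow> ereal" where
  "emp_min_risk P n x = (INF \<phi> \<in> hyps P. emp_risk P n x \<phi>)"

text \<open>Only meaningful for nonempty \<open>E\<close> (it is an infimum of reals).\<close>

definition metr_to_set :: "('m, 'x) erm_problem \<Rightarrow> 'm \<Rightarrow> 'm set \<Rightarrow> real" where
  "metr_to_set P \<phi> E = (INF \<psi> \<in> E. metr P \<phi> \<psi>)"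

definition measure_support :: "'x::topological_space measure \<Rightarrow> 'x set" where
  "measure_support \<mu> = {x. \<forall>U. open U \<longrightarrow> x \<in> U \<longrightarrow> emeasure \<mu> U > 0}"

text \<open>Points at distance \<open>0\<close> from the empirical solution set are disregarded; an infimum over
  no points is \<open>\<infinity>\<close>.\<close>

definition tau_hat ::
  "('m, 'x::topological_space) erm_problem \<Rightarrow> ereal \<Rightarrow> real \<Rightarrow> nat \<Rightarrow> (nat \<Rightarrow> 'x) \<Rightarrow> ereal" where
  "tau_hat P J0 \<beta> n x =
     (INF y \<in> ({..<n} \<rightarrow>\<^sub>E measure_support (law P)).
        INF \<phi> \<in> {\<phi> \<in> hyps P. risk P \<phi> \<le> J0 \<and> \<phi> \<in> emp_sols P n y \<and>
                         metr_to_set P \<phi> (emp_sols P n x) \<noteq> 0}.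
          (emp_risk P n x \<phi> - emp_min_risk P n x) /
          ereal (metr_to_set P \<phi> (emp_sols P n x) powr \<beta>))"

text \<open>Membership in the \<open>\<sigma>\<close>-algebra is required because \<^const>\<open>measure\<close> is \<open>0\<close> on
  non-measurable sets.\<close>

definition prob_le :: "'a measure \<Rightarrow> ('a \<Rightarrow> bool) \<Rightarrow> real \<Rightarrow> bool" where
  "prob_le M E p \<longleftrightarrow> {x \<in> space M. E x} \<in> sets M \<and> measure M {x \<in> space M. E x} \<le> p"

definition vanishing_rate :: "(nat \<Rightarrow> real) \<Rightarrow> bool" where
  "vanishing_rate r \<longleftrightarrow> (\<forall>n. 0 \<le> r n \<and> r n \<le> 1) \<and> r \<longlonglongrightarrow> 0"

definition pseudometric :: "('x \<Rightarrow> 'x \<Rightarrow> real) \<Rightarrow> bool" where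
  "pseudometric a \<longleftrightarrow>
     (\<forall>x. a x x = 0) \<and> (\<forall>x y. 0 \<le> a x y) \<and> (\<forall>x y. a x y = a y x) \<and>
     (\<forall>x y z. a x z \<le> a x y + a y z)"

text \<open>The Orlicz norm of \<open>a(X, Y)\<close> for independent \<open>X\<close>, \<open>Y\<close> of law \<open>\<mu>\<close>.\<close>

definition pseudometric_psi1 :: "'x measure \<Rightarrow> ('x \<Rightarrow> 'x \<Rightarrow> real) \<Rightarrow> ennreal" where
  "pseudometric_psi1 \<mu> a = psi_norm 1 (\<mu> \<Otimes>\<^sub>M \<mu>) (\<lambda>(x, y). a x y)"

subsection \<open>Assumptions on the problem\<close>

text \<open>``The empirical minimizers are measurable functions of the sample'' is read as the existence
  of a measurable selection; that every selection be measurable is impossible as soon as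
  minimizers are not unique. Measurability is with respect to the Borel sets of the ambient type.\<close>

definition minimizers_exist :: "('m::topological_space, 'x) erm_problem \<Rightarrow> bool" where
  "minimizers_exist P \<longleftrightarrow>
     proper_on (hyps P) (risk P) \<and> sols P \<noteq> {} \<and>
     (\<forall>n\<ge>1.
        (AE x in sample P n.
           proper_on (hyps P) (emp_risk P n x) \<and> emp_sols P n x \<noteq> {}) \<and>
        (\<exists>f \<in> borel_measurable (sample P n). AE x in sample P n. f x \<in> emp_sols P n x))"

definition growth_condition ::
  "('m, 'x) erm_problem \<Rightarrow> ereal \<Rightarrow> real \<Rightarrow> real \<Rightarrow> bool" where
  "growth_condition P J0 \<beta> \<tau> \<longleftrightarrow>
     min_risk P < J0 \<and> \<beta> \<ge> 1 \<and> \<tau> > 0 \<and>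
     (\<forall>\<phi>\<in>hyps P. risk P \<phi> \<le> J0 \<longrightarrow>
        ereal (\<tau> * metr_to_set P \<phi> (sols P) powr \<beta>) \<le> risk P \<phi> - min_risk P)"

definition emp_sols_in_sublevel ::
  "('m, 'x) erm_problem \<Rightarrow> ereal \<Rightarrow> (nat \<Rightarrow> real) \<Rightarrow> bool" where
  "emp_sols_in_sublevel P J0 \<eta> \<longleftrightarrow>
     vanishing_rate \<eta> \<and>
     (\<forall>n\<ge>1. prob_le (sample P n) (\<lambda>x. (SUP \<phi> \<in> emp_sols P n x. risk P \<phi>) > J0) (\<eta> n))"

definition emp_growth_condition ::
  "('m, 'x::topological_space) erm_problem \<Rightarrow> ereal \<Rightarrow> real \<Rightarrow> real \<Rightarrow> (nat \<Rightarrow> real) \<Rightarrow> bool" where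
  "emp_growth_condition P J0 \<beta> \<tau> \<kappa> \<longleftrightarrow>
     vanishing_rate \<kappa> \<and>
     (\<forall>n\<ge>1. prob_le (sample P n) (\<lambda>x. tau_hat P J0 \<beta> n x < ereal (\<tau> / 2)) (\<kappa> n))"

definition loss_regularity ::
  "('m, 'x) erm_problem \<Rightarrow> real \<Rightarrow> ('x \<Rightarrow> 'x \<Rightarrow> real) \<Rightarrow> (nat \<Rightarrow> real) \<Rightarrow> bool" where
  "loss_regularity P \<alpha> a \<iota> \<longleftrightarrow>
     \<alpha> > 0 \<and> pseudometric a \<and>
     (\<lambda>(x, y). a x y) \<in> borel_measurable (law P \<Otimes>\<^sub>M law P) \<and>
     pseudometric_psi1 (law P) a < \<infinity> \<and> vanishing_rate \<iota> \<and>
     (\<exists>\<Upsilon> \<subseteq> hyps P. sols P \<subseteq> \<Upsilon> \<and>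
        (\<forall>\<phi>\<in>\<Upsilon>. \<forall>\<psi>\<in>\<Upsilon>. AE (x, y) in law P \<Otimes>\<^sub>M law P.
           loss P \<phi> x - loss P \<psi> x - loss P \<phi> y + loss P \<psi> y \<le> a x y * metr P \<phi> \<psi> powr \<alpha>) \<and>
        (\<forall>n\<ge>1. prob_le (sample P n) (\<lambda>x. \<not> emp_sols P n x \<subseteq> \<Upsilon>) (\<iota> n)))"

subsection \<open>Principal component analysis\<close>

definition covariance :: "(real ^ 'd) measure \<Rightarrow> real ^ 'd ^ 'd" where
  "covariance \<mu> = (\<chi> i j. \<integral>x. x $ i * x $ j \<partial>\<mu>)"

text \<open>\<open>lam 1, \<dots>, lam d\<close> are the roots of the characteristic polynomial, with multiplicity.\<close>

definition ordered_eigenvalues :: "real ^ 'd ^ 'd \<Rightarrow> (nat \<Rightarrow> real) \<Rightarrow> bool" where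
  "ordered_eigenvalues A lam \<longleftrightarrow>
     antimono_on {1..CARD('d)} lam \<and>
     (\<forall>t. det (mat t - A) = (\<Prod>i = 1..CARD('d). t - lam i))"

definition pca_problem :: "(real ^ 'd) measure \<Rightarrow> (real ^ 'd, real ^ 'd) erm_problem" where
  "pca_problem \<mu> =
     \<lparr>hyps = sphere 0 1,
      metr = (\<lambda>\<phi> \<psi>. arccos (\<phi> \<bullet> \<psi>)),
      loss = (\<lambda>\<phi> x. - (\<phi> \<bullet> x)\<^sup>2),
      penalty = (\<lambda>_. 0),
      law = \<mu>\<rparr>"

definition pca_pseudometric :: "real ^ 'd \<Rightarrow> real ^ 'd \<Rightarrow> real" where
  "pca_pseudometric x y = 2 * ((norm x)\<^sup>2 + (norm y)\<^sup>2) * of_bool (x \<noteq> y)"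

definition pca_rate_const :: "nat \<Rightarrow> real \<Rightarrow> real \<Rightarrow> real" where
  "pca_rate_const d K g =
     g\<^sup>2 / (32 * (exp 1)\<^sup>2 * (real d + 1)\<^sup>2 * K ^ 4 + 8 * exp 1 * (real d + 1) * K\<^sup>2 * g)"

end

theory Submission
  imports Defs
begin

text \<open>
  Write \<open>\<Sigma>\<close> for the covariance and \<open>\<Sigma>\<^sub>n\<close> for the empirical covariance matrix, so that the risks are
  \<open>-\<langle>\<phi>, \<Sigma>\<phi>\<rangle>\<close> and \<open>-\<langle>\<phi>, \<Sigma>\<^sub>n\<phi>\<rangle>\<close>. For a symmetric matrix whose form drops by at least \<open>G\<close> from its
  maximum on the sphere to the orthogonal complement of a maximiser, the suboptimality of \<open>\<phi>\<close> at
  angle \<open>\<theta>\<close> is at least \<open>G sin\<^sup>2 \<theta> \<ge> G (2\<theta>/\<pi>)\<^sup>2\<close>. For \<open>\<Sigma>\<close> this holds with \<open>G = \<lambda>\<^sub>1 - \<lambda>\<^sub>2\<close>, and for \<open>\<Sigma>\<^sub>n\<close>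
  with \<open>G / 2\<close> as soon as \<open>\<Sigma>\<^sub>n\<close> is within \<open>G / 4\<close> of \<open>\<Sigma>\<close>. That this fails is exponentially unlikely,
  even in Frobenius norm: the matrices \<open>XX\<^sup>T - \<Sigma>\<close> satisfy the Bernstein moment condition with
  \<open>R = e (d + 1) K\<^sup>2\<close>, \<open>K\<close> the subgaussian norm, and Pinelis' Bernstein inequality for sums in a Hilbert space has the
  dimension-free prefactor \<open>2\<close>, so no matrix Bernstein inequality is needed. The event in question is
  measurable because it is the preimage of an open set of matrices under \<open>\<Sigma>\<^sub>n\<close>.
\<close>

section \<open>Symmetric matrices\<close>

lemma symmetric_inner_commute:
  fixes A :: "real ^ 'd ^ 'd"
  assumes "transpose A = A"
  shows "x \<bullet> (A *v y) = y \<bullet> (A *v x)"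
  by (metis assms dot_lmul_matrix inner_commute transpose_matrix_vector)

text \<open>This is the first-order condition at a maximiser. Moving from \<open>v\<close> to
  \<open>v + t *\<^sub>R w\<close> inside \<open>S\<close> gives \<open>2 * t * b\<close> at most
  \<open>t\<^sup>2 * C\<close> for every real t of either sign, which forces b = 0. The subspace
  \<open>S\<close> allows use both inside an invariant subspace and on the whole space.\<close>

lemma rayleigh_max_orthogonal:
  fixes A :: "real ^ 'd ^ 'd"
  assumes sym: "transpose A = A" and S: "subspace S"
    and v: "v \<in> S" "norm v = 1"
    and max: "\<And>w. w \<in> S \<Longrightarrow> norm w = 1 \<Longrightarrow> w \<bullet> (A *v w) \<le> v \<bullet> (A *v v)"
    and w: "w \<in> S" "v \<bullet> w = 0"
  shows "v \<bullet> (A *v w) = 0"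
proof -
  define b where "b = v \<bullet> (A *v w)"
  define C where "C = v \<bullet> (A *v v) * (norm w)\<^sup>2 - w \<bullet> (A *v w)"
  have hom: "u \<bullet> (A *v u) \<le> v \<bullet> (A *v v) * (norm u)\<^sup>2" if "u \<in> S" for u
  proof (cases "u = 0")
    case False
    let ?u = "(1 / norm u) *\<^sub>R u"
    have "?u \<in> S" "norm ?u = 1" using that S False by (auto simp: subspace_scale)
    from max[OF this] have "(u \<bullet> (A *v u)) / (norm u)\<^sup>2 \<le> v \<bullet> (A *v v)"
      by (simp add: matrix_vector_mult_scaleR power2_eq_square)
    thus ?thesis using False by (simp add: field_simps)
  qed simp
  have "2 * t * b \<le> t\<^sup>2 * C" for t
  proof -
    have "v + t *\<^sub>R w \<in> S" using v w S by (simp add: subspace_add subspace_scale)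
    moreover have "(norm (v + t *\<^sub>R w))\<^sup>2 = 1 + t\<^sup>2 * (norm w)\<^sup>2"
      using w(2) v(2) unfolding power2_norm_eq_inner
      by (simp add: inner_simps norm_eq_1 inner_commute power2_eq_square)
    ultimately have "(v + t *\<^sub>R w) \<bullet> (A *v (v + t *\<^sub>R w)) \<le> v \<bullet> (A *v v) * (1 + t\<^sup>2 * (norm w)\<^sup>2)"
      using hom by metis
    thus ?thesis
      using symmetric_inner_commute[OF sym, of w v]
      by (simp add: C_def b_def matrix_vector_right_distrib matrix_vector_mult_scaleR inner_simps
          algebra_simps power2_eq_square)
  qed
  note q = this
  have "b = 0"
  proof (rule ccontr)
    assume "b \<noteq> 0"
    \<comment> \<open>For this t the quadratic term is at most t b, so 2 t b would be at most t b
      although t b is positive. The summand 1 keeps the denominator positive when C = 0.\<close>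
    define t where "t = b / (\<bar>C\<bar> + 1)"
    have "t\<^sup>2 * C \<le> t\<^sup>2 * (\<bar>C\<bar> + 1)" by (intro mult_left_mono) auto
    also have "\<dots> = t * b"
      unfolding t_def power2_eq_square by (simp add: add_pos_nonneg add_nonneg_eq_0_iff)
    finally have "t * b \<le> 0" using q[of t] by linarith
    moreover have "t * b > 0"
      using \<open>b \<noteq> 0\<close> by (simp add: t_def power2_eq_square[symmetric] add_nonneg_pos)
    ultimately show False by simp
  qed
  thus ?thesis by (simp add: b_def)
qed

lemma continuous_on_rayleigh:
  "continuous_on UNIV (\<lambda>x. x \<bullet> (A *v x))" for A :: "real ^ 'd ^ 'd"
  by (intro continuous_intros linear_continuous_on linear_conv_bounded_linear[THEN iffD1]) simp_all

text \<open>A maximiser v of the quadratic form on the unit sphere of \<open>S\<close> is an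
  eigenvector: its residual r = Av - mv lies in \<open>S\<close> by invariance and is orthogonal to
  v, so the first-order condition makes r orthogonal to Av as well, and hence to itself.\<close>

lemma invariant_subspace_eigenvector:
  fixes A :: "real ^ 'd ^ 'd"
  assumes sym: "transpose A = A" and S: "subspace S" "S \<noteq> {0}"
    and inv: "\<And>x. x \<in> S \<Longrightarrow> A *v x \<in> S"
  obtains v m where "v \<in> S" "norm v = 1" "A *v v = m *\<^sub>R v"
proof -
  have "compact (S \<inter> sphere 0 1)"
    using S by (simp add: closed_subspace compact_Int_closed closed_Int_compact)
  moreover have "S \<inter> sphere 0 1 \<noteq> {}"
  proof -
    from S obtain x where "x \<in> S" "x \<noteq> 0" using subspace_0 by blast
    hence "(1 / norm x) *\<^sub>R x \<in> S \<inter> sphere 0 1" using S by (auto simp: subspace_scale)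
    thus ?thesis by blast
  qed
  ultimately obtain v where v: "v \<in> S \<inter> sphere 0 1"
    "\<And>w. w \<in> S \<inter> sphere 0 1 \<Longrightarrow> w \<bullet> (A *v w) \<le> v \<bullet> (A *v v)"
    using continuous_attains_sup[of "S \<inter> sphere 0 1" "\<lambda>x. x \<bullet> (A *v x)"]
      continuous_on_subset[OF continuous_on_rayleigh, of _ A] by blast
  define m where "m = v \<bullet> (A *v v)"
  define r where "r = A *v v - m *\<^sub>R v"
  have vS: "v \<in> S" "norm v = 1" using v by auto
  hence r: "r \<in> S" "v \<bullet> r = 0"
    using inv S by (auto simp: r_def m_def subspace_diff subspace_scale inner_diff_right norm_eq_1)
  have "v \<bullet> (A *v r) = 0"
    by (rule rayleigh_max_orthogonal[OF sym S(1) vS _ r]) (use v in auto)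
  hence "r \<bullet> (A *v v) = 0" using symmetric_inner_commute[OF sym] by metis
  moreover have "r \<bullet> r = r \<bullet> (A *v v) - m * (v \<bullet> r)"
    by (subst (2) r_def) (simp add: inner_diff_right inner_commute)
  ultimately have "r \<bullet> r = 0" using r(2) by simp
  hence "A *v v = m *\<^sub>R v" by (simp add: r_def)
  with vS show ?thesis using that by blast
qed

text \<open>Take an orthonormal set of eigenvectors of maximal cardinality. Its orthogonal
  complement is invariant under \<open>A\<close>, so if nonzero it would supply one more
  eigenvector. Indexing the basis by the dimension type lets it form a square matrix.\<close>

theorem symmetric_eigenbasis:
  fixes A :: "real ^ 'd ^ 'd"
  assumes sym: "transpose A = A"
  obtains b :: "'d \<Rightarrow> real ^ 'd" and m
  where "\<And>i j. b i \<bullet> b j = of_bool (i = j)" "\<And>i. A *v b i = m i *\<^sub>R b i"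
proof -
  define good where "good B \<longleftrightarrow> pairwise orthogonal B \<and>
      (\<forall>v\<in>B. norm v = 1 \<and> (\<exists>m. A *v v = m *\<^sub>R v))" for B :: "(real ^ 'd) set"
  have indep: "independent B" if "good B" for B
  proof -
    have "0 \<notin> B" using that by (auto simp: good_def)
    thus ?thesis using that pairwise_orthogonal_independent by (auto simp: good_def)
  qed
  hence fin: "finite B" "card B \<le> CARD('d)" if "good B" for B
    using that independent_bound[of B] by auto
  have "good {}" by (simp add: good_def)
  hence "\<exists>B. good B \<and> (\<forall>B'. good B' \<longrightarrow> card B' \<le> card B)"
    by (rule ex_has_greatest_nat[of good "{}" card "Suc CARD('d)"]) (use fin(2) in \<open>auto simp: less_Suc_eq_le\<close>)
  then obtain B where B: "good B" "\<And>B'. good B' \<Longrightarrow> card B' \<le> card B" by blast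
  define S where "S = {x. \<forall>b\<in>B. b \<bullet> x = 0}"
  have S: "subspace S" by (auto simp: S_def subspace_def inner_simps)
  have inv: "A *v x \<in> S" if x: "x \<in> S" for x
  proof -
    have "b \<bullet> (A *v x) = 0" if "b \<in> B" for b
    proof -
      from that B obtain m where "A *v b = m *\<^sub>R b" unfolding good_def by blast
      thus ?thesis
        using symmetric_inner_commute[OF sym, of b x] x that by (simp add: S_def inner_commute)
    qed
    thus ?thesis by (simp add: S_def)
  qed
  have "S = {0}"
  proof (rule ccontr)
    assume "S \<noteq> {0}"
    then obtain v m where v: "v \<in> S" "norm v = 1" "A *v v = m *\<^sub>R v"
      by (rule invariant_subspace_eigenvector[OF sym S _ inv]) blast
    have "good (insert v B)"
      using B(1) v by (simp add: good_def S_def pairwise_insert orthogonal_def inner_commute[of v])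
    moreover have "v \<notin> B" using v by (auto simp: S_def)
    ultimately show False using B(2)[of "insert v B"] fin[OF B(1)] by simp
  qed
  have "span B = UNIV"
  proof (rule ccontr)
    assume "span B \<noteq> UNIV"
    then obtain a where "a \<noteq> 0" "\<forall>x\<in>span B. a \<bullet> x = 0"
      using span_not_UNIV_orthogonal by blast
    hence "a \<in> S" by (simp add: S_def span_base inner_commute[of _ a])
    thus False using \<open>S = {0}\<close> \<open>a \<noteq> 0\<close> by blast
  qed
  hence "card B = CARD('d)"
    using dim_span_eq_card_independent[OF indep[OF B(1)]] by simp
  then obtain b where b: "bij_betw b (UNIV :: 'd set) B"
    using finite_same_card_bij[OF finite_class.finite_UNIV fin(1)[OF B(1)]] by auto
  have bB: "b i \<in> B" for i using b by (auto simp: bij_betw_def)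
  have 1: "b i \<bullet> b j = of_bool (i = j)" for i j
  proof (cases "i = j")
    case True thus ?thesis using B(1) bB[of i] by (auto simp: good_def norm_eq_1)
  next
    case False
    hence "b i \<noteq> b j" using b by (auto simp: bij_betw_def inj_on_def)
    thus ?thesis using False B(1) bB by (auto simp: good_def pairwise_def orthogonal_def)
  qed
  have "\<forall>i. \<exists>m. A *v b i = m *\<^sub>R b i"
    using B(1) bB by (simp add: good_def)
  then obtain m where "\<forall>i. A *v b i = m i *\<^sub>R b i" by (rule choice[THEN exE])
  thus ?thesis using 1 that by blast
qed

section \<open>Ordered eigenvalues and the spectral gap\<close>

text \<open>With the eigenvectors as columns of Q, (t - A) Q = Q D for a diagonal D, and det Q
  cancels because Q is orthogonal.\<close>

lemma charpoly_eigenbasis: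
  fixes A :: "real ^ 'd ^ 'd" and b :: "'d \<Rightarrow> real ^ 'd"
  assumes on: "\<And>i j. b i \<bullet> b j = of_bool (i = j)" and eig: "\<And>i. A *v b i = m i *\<^sub>R b i"
  shows "det (mat t - A) = (\<Prod>i\<in>UNIV. t - m i)"
proof -
  define Q where "Q = transpose (\<chi> i. b i)"
  define D :: "real ^ 'd ^ 'd" where "D = (\<chi> i j. if i = j then t - m i else 0)"
  have QQ: "transpose Q ** Q = mat 1"
    using on by (simp add: Q_def vec_eq_iff matrix_matrix_mult_def transpose_def mat_def inner_vec_def)
  have eig': "(mat t - A) *v b i = (t - m i) *\<^sub>R b i" for i
  proof -
    have "mat t *v b i = t *\<^sub>R b i"
      by (simp add: vec_eq_iff matrix_vector_mult_def mat_def if_distrib[of "\<lambda>x. x * _"] cong: if_cong)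
    thus ?thesis using eig[of i] by (simp add: matrix_vector_mult_diff_rdistrib algebra_simps)
  qed
  have "(mat t - A) ** Q = Q ** D"
  proof -
    have "((mat t - A) ** Q) $ k $ i = (Q ** D) $ k $ i" for k i
    proof -
      have "((mat t - A) ** Q) $ k $ i = ((mat t - A) *v b i) $ k"
        by (simp add: matrix_matrix_mult_def matrix_vector_mult_def Q_def transpose_def)
      also have "\<dots> = (t - m i) * b i $ k" by (simp add: eig')
      also have "\<dots> = (Q ** D) $ k $ i"
        by (simp add: matrix_matrix_mult_def Q_def transpose_def D_def if_distrib[of "\<lambda>x. _ * x"] cong: if_cong)
      finally show ?thesis .
    qed
    thus ?thesis by (simp add: vec_eq_iff)
  qed
  hence "det (mat t - A) * det Q = det Q * det D" by (metis det_mul)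
  moreover have "det Q \<noteq> 0" using arg_cong[OF QQ, of det] by (auto simp: det_mul)
  ultimately have "det (mat t - A) = det D" by simp
  also have "\<dots> = (\<Prod>i\<in>UNIV. t - m i)" by (subst det_diagonal) (auto simp: D_def)
  finally show ?thesis .
qed

text \<open>The numbers \<open>lam\<close> are known only as roots of the characteristic polynomial,
  so they must be matched with the eigenvalues \<open>m\<close> of an eigenbasis. Some index i has m
  i = lam 1, and all others have m j at most lam 2. Expanding w orthogonal to b i in the basis then
  bounds its form.\<close>

lemma spectral_gap:
  fixes A :: "real ^ 'd ^ 'd"
  assumes sym: "transpose A = A" and ev: "ordered_eigenvalues A lam" and gap: "lam 1 > lam 2"
    and dim: "CARD('d) \<ge> 2"
  obtains v where "norm v = 1" "A *v v = lam 1 *\<^sub>R v"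
    "\<And>w. v \<bullet> w = 0 \<Longrightarrow> w \<bullet> (A *v w) \<le> lam 2 * (norm w)\<^sup>2"
proof -
  obtain b :: "'d \<Rightarrow> real ^ 'd" and m where on: "\<And>i j. b i \<bullet> b j = of_bool (i = j)" and eig: "\<And>i. A *v b i = m i *\<^sub>R b i"
    using symmetric_eigenbasis[OF sym] by metis
  have prod: "(\<Prod>i\<in>UNIV. t - m i) = (\<Prod>k=1..CARD('d). t - lam k)" for t
    using ev charpoly_eigenbasis[OF on eig, of t] by (simp add: ordered_eigenvalues_def)
  have le: "lam k \<le> lam 2" if "k \<in> {2..CARD('d)}" for k
    using ev that by (auto simp: ordered_eigenvalues_def monotone_on_def)
  have "(\<Prod>k=1..CARD('d). lam 1 - lam k) = 0" using dim by (intro prod_zero) auto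
  hence "(\<Prod>i\<in>UNIV. lam 1 - m i) = 0" by (simp only: prod)
  then obtain i where i: "m i = lam 1" by auto
  have rest: "(\<Prod>j\<in>UNIV-{i}. t - m j) = (\<Prod>k=2..CARD('d). t - lam k)" if "t \<noteq> lam 1" for t
  proof -
    have "(t - lam 1) * (\<Prod>j\<in>UNIV-{i}. t - m j) = (\<Prod>j\<in>UNIV. t - m j)"
      using prod.remove[of UNIV i "\<lambda>j. t - m j"] i by simp
    also have "\<dots> = (t - lam 1) * (\<Prod>k=2..CARD('d). t - lam k)"
      unfolding prod using dim prod.atLeast_Suc_atMost[of 1 "CARD('d)" "\<lambda>k. t - lam k"]
      by (simp add: numeral_2_eq_2)
    finally show ?thesis using that by simp
  qed
  \<comment> \<open>Cancelling the factor t - lam 1 is legitimate only away from lam 1. At lam 1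
    itself the two reduced products agree by continuity.\<close>
  have rest1: "(\<Prod>j\<in>UNIV-{i}. lam 1 - m j) = (\<Prod>k=2..CARD('d). lam 1 - lam k)"
  proof (rule tendsto_unique)
    show "((\<lambda>t. \<Prod>j\<in>UNIV-{i}. t - m j) \<longlongrightarrow> (\<Prod>j\<in>UNIV-{i}. lam 1 - m j)) (at (lam 1))"
      by (intro tendsto_intros)
    have "((\<lambda>t. \<Prod>k=2..CARD('d). t - lam k) \<longlongrightarrow> (\<Prod>k=2..CARD('d). lam 1 - lam k)) (at (lam 1))"
      by (intro tendsto_intros)
    thus "((\<lambda>t. \<Prod>j\<in>UNIV-{i}. t - m j) \<longlongrightarrow> (\<Prod>k=2..CARD('d). lam 1 - lam k)) (at (lam 1))"
      by (rule Lim_transform_eventually) (auto simp: eventually_at_filter rest)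
  qed simp
  have ne1: "(\<Prod>k=2..CARD('d). lam 1 - lam k) \<noteq> 0"
  proof -
    have "lam 1 - lam k \<noteq> 0" if "k \<in> {2..CARD('d)}" for k using le[OF that] gap by linarith
    thus ?thesis by (simp add: prod_zero_iff)
  qed
  \<comment> \<open>The reduced product vanishes at m j but, by the gap, not at lam 1. So m j
    differs from lam 1 and must be one of the roots lam 2, lam 3, ...\<close>
  have mle: "m j \<le> lam 2" if "j \<noteq> i" for j
  proof -
    have z: "(\<Prod>j'\<in>UNIV-{i}. m j - m j') = 0" using that by (intro prod_zero) auto
    have "m j \<noteq> lam 1"
    proof
      assume "m j = lam 1"
      with z rest1 ne1 show False by (simp only:)
    qed
    from z rest[OF this] have "\<exists>k\<in>{2..CARD('d)}. m j = lam k" by auto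
    thus ?thesis using le by auto
  qed
  have lin: "linear (\<lambda>w. A *v w)" by simp
  show ?thesis
  proof
    show "norm (b i) = 1" using on[of i i] by (simp add: norm_eq_1)
    show "A *v b i = lam 1 *\<^sub>R b i" using eig[of i] i by simp
    fix w assume w: "b i \<bullet> w = 0"
    have inj: "inj b" 
    proof (rule injI)
      fix j k assume "b j = b k"
      hence "b j \<bullet> b k = 1" using on[of j j] by simp
      thus "j = k" by (simp add: on split: if_splits)
    qed
    have ort: "pairwise orthogonal (range b)" using on by (auto simp: pairwise_def orthogonal_def)
    have "0 \<notin> range b" 
    proof
      assume "0 \<in> range b"
      then obtain j where "b j = 0" by auto
      thus False using on[of j j] by simp
    qed
    hence "independent (range b)" using pairwise_orthogonal_independent[OF ort] by blast
    moreover have "card (range b) = CARD('d)" using inj by (simp add: card_image)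
    ultimately have sp: "span (range b) = UNIV"
      using card_eq_dim[of "range b" UNIV] by (simp add: top.extremum_unique)
    have expand: "w = (\<Sum>j\<in>UNIV. (b j \<bullet> w) *\<^sub>R b j)"
    proof -
      let ?z = "w - (\<Sum>j\<in>UNIV. (b j \<bullet> w) *\<^sub>R b j)"
      have "b k \<bullet> ?z = 0" for k
        by (simp add: inner_diff_right inner_sum_right on)
      hence "orthogonal ?z y" if "y \<in> range b" for y using that by (auto simp: orthogonal_def inner_commute)
      hence "orthogonal ?z ?z" using orthogonal_to_span[of ?z "range b" ?z] sp by simp
      hence "?z = 0" by (simp only: orthogonal_self)
      thus ?thesis by (simp only: right_minus_eq)
    qed
    have "w \<bullet> (A *v w) = (\<Sum>j\<in>UNIV. m j * (b j \<bullet> w)\<^sup>2)"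
    proof -
      have "A *v w = (\<Sum>j\<in>UNIV. (b j \<bullet> w) *\<^sub>R (m j *\<^sub>R b j))"
        using arg_cong[OF expand, of "(*v) A"] by (simp only: linear_sum[OF lin] matrix_vector_mult_scaleR eig)
      thus ?thesis by (simp add: inner_sum_right power2_eq_square inner_commute mult_ac)
    qed
    also have "\<dots> \<le> (\<Sum>j\<in>UNIV. lam 2 * (b j \<bullet> w)\<^sup>2)"
    proof (intro sum_mono)
      fix j show "m j * (b j \<bullet> w)\<^sup>2 \<le> lam 2 * (b j \<bullet> w)\<^sup>2"
        by (cases "j = i") (auto simp: w mle intro: mult_right_mono)
    qed
    also have "\<dots> = lam 2 * (w \<bullet> w)"
    proof -
      have "w \<bullet> w = (\<Sum>j\<in>UNIV. (b j \<bullet> w) *\<^sub>R b j) \<bullet> w" by (simp only: expand[symmetric])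
      also have "\<dots> = (\<Sum>j\<in>UNIV. (b j \<bullet> w)\<^sup>2)"
        by (simp add: inner_sum_left power2_eq_square)
      finally show ?thesis by (simp add: sum_distrib_left)
    qed
    finally show "w \<bullet> (A *v w) \<le> lam 2 * (norm w)\<^sup>2" by (simp add: power2_norm_eq_inner)
  qed
qed

section \<open>Rayleigh quotients\<close>

text \<open>The rank-one matrix x x^T. The inner product of nested vectors is the Frobenius one, so
  pairing with \<open>outer x\<close> makes quadratic forms linear in the matrix, and empirical
  covariances become averages of independent vectors in a Euclidean space.\<close>

definition outer :: "real ^ 'd \<Rightarrow> real ^ 'd ^ 'd" where
  "outer x = (\<chi> i j. x $ i * x $ j)"

lemma inner_outer: "A \<bullet> outer x = x \<bullet> (A *v x)"
  by (simp add: outer_def inner_vec_def matrix_vector_mult_def sum_distrib_left mult_ac)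

lemma inner_outer_outer: "outer x \<bullet> outer y = (x \<bullet> y)\<^sup>2"
  by (simp add: outer_def inner_vec_def power2_eq_square sum_product mult_ac)

lemma norm_outer: "norm (outer x) = (norm x)\<^sup>2"
proof -
  have "(norm (outer x))\<^sup>2 = ((norm x)\<^sup>2)\<^sup>2"
    unfolding power2_norm_eq_inner inner_outer_outer ..
  thus ?thesis by (rule power2_eq_imp_eq) auto
qed

lemma continuous_on_outer [continuous_intros]:
  "continuous_on S f \<Longrightarrow> continuous_on S (\<lambda>x. outer (f x))"
  unfolding outer_def by (intro continuous_intros)

lemma abs_rayleigh_le: "\<bar>x \<bullet> (A *v x)\<bar> \<le> norm A * (norm x)\<^sup>2" for A :: "real ^ 'd ^ 'd"
  using Cauchy_Schwarz_ineq2[of A "outer x"] by (simp add: inner_outer norm_outer)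

text \<open>The common shape of the true and the empirical solution sets, for the true and the
  empirical covariance; facts on compactness, angles and measurability are thus proved once.\<close>

definition rayleigh_argmax :: "real ^ 'd ^ 'd \<Rightarrow> (real ^ 'd) set" where
  "rayleigh_argmax A =
     {\<phi> \<in> sphere 0 1. \<forall>\<psi>\<in>sphere 0 1. \<psi> \<bullet> (A *v \<psi>) \<le> \<phi> \<bullet> (A *v \<phi>)}"

text \<open>Joint closedness in vector and matrix is what projection along the compact sphere
  requires. The unit-norm constraint on the vector is left to the compact factor of that
  projection.\<close>

lemma closed_rayleigh_argmax_graph:
  "closed {p :: (real ^ 'd) \<times> (real ^ 'd ^ 'd).
     \<forall>\<psi>\<in>sphere 0 1. \<psi> \<bullet> (snd p *v \<psi>) \<le> fst p \<bullet> (snd p *v fst p)}"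
  unfolding inner_outer[symmetric] Ball_def
  by (intro closed_Collect_all closed_Collect_imp closed_Collect_le continuous_intros) auto

lemma rayleigh_argmax_nonempty: "rayleigh_argmax A \<noteq> {}"
proof -
  have "compact (sphere 0 1 :: (real ^ 'a) set)" "sphere 0 1 \<noteq> ({} :: (real ^ 'a) set)" by auto
  from continuous_attains_sup[OF this continuous_on_subset[OF continuous_on_rayleigh[of A]]]
  show ?thesis by (auto simp: rayleigh_argmax_def)
qed

lemma closed_rayleigh_argmax: "closed (rayleigh_argmax A)"
proof -
  have "rayleigh_argmax A = sphere 0 1 \<inter>
      {\<phi>. \<forall>\<psi>\<in>sphere 0 1. \<psi> \<bullet> (A *v \<psi>) \<le> \<phi> \<bullet> (A *v \<phi>)}"
    by (auto simp: rayleigh_argmax_def)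
  also have "closed \<dots>"
    unfolding Ball_def
    by (intro closed_Int closed_sphere closed_Collect_all closed_Collect_imp closed_Collect_le
        continuous_on_const continuous_on_rayleigh) auto
  finally show ?thesis .
qed

lemma compact_rayleigh_argmax: "compact (rayleigh_argmax A)"
proof -
  have "rayleigh_argmax A = sphere 0 1 \<inter> rayleigh_argmax A" by (auto simp: rayleigh_argmax_def)
  thus ?thesis using compact_Int_closed[OF compact_sphere closed_rayleigh_argmax] by metis
qed

lemma uminus_rayleigh_argmax: "v \<in> rayleigh_argmax A \<Longrightarrow> - v \<in> rayleigh_argmax A"
  by (simp add: rayleigh_argmax_def matrix_vector_mult_def sum_negf inner_vec_def vec_eq_iff)

text \<open>Split a unit vector into its component along v and a remainder w. The cross terms vanish
  because v is an eigenvector, leaving a value at most l1 times the total squared norm.\<close>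

lemma eigenvector_in_rayleigh_argmax:
  fixes A :: "real ^ 'd ^ 'd"
  assumes sym: "transpose A = A" and v: "norm v = 1" "A *v v = l1 *\<^sub>R v"
    and gap: "\<And>w. v \<bullet> w = 0 \<Longrightarrow> w \<bullet> (A *v w) \<le> l2 * (norm w)\<^sup>2" and le: "l2 \<le> l1"
  shows "v \<in> rayleigh_argmax A"
proof -
  have "\<phi> \<bullet> (A *v \<phi>) \<le> v \<bullet> (A *v v)" if \<phi>: "norm \<phi> = 1" for \<phi>
  proof -
    define c where "c = v \<bullet> \<phi>"
    define w where "w = \<phi> - c *\<^sub>R v"
    have vv: "v \<bullet> v = 1" using v(1) by (simp add: norm_eq_1)
    have vw: "v \<bullet> w = 0" "w \<bullet> v = 0"
      by (simp_all add: w_def inner_diff_right inner_diff_left c_def vv inner_commute)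
    have \<phi>w: "\<phi> = c *\<^sub>R v + w" by (simp add: w_def)
    have "(norm \<phi>)\<^sup>2 = c\<^sup>2 + (norm w)\<^sup>2"
      unfolding \<phi>w power2_norm_eq_inner using vw vv by (simp add: inner_simps power2_eq_square)
    hence nw: "c\<^sup>2 + (norm w)\<^sup>2 = 1" using \<phi> by simp
    have "\<phi> \<bullet> (A *v \<phi>) = c\<^sup>2 * l1 + w \<bullet> (A *v w)"
      unfolding \<phi>w using vw vv symmetric_inner_commute[OF sym, of v w] v(2)
      by (simp add: matrix_vector_right_distrib matrix_vector_mult_scaleR inner_simps power2_eq_square)
    also have "\<dots> \<le> c\<^sup>2 * l1 + l1 * (norm w)\<^sup>2"
      using gap[OF vw(1)] mult_right_mono[of l2 l1 "(norm w)\<^sup>2"] le by simp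
    also have "\<dots> = l1 * (c\<^sup>2 + (norm w)\<^sup>2)" by (simp add: algebra_simps)
    finally show ?thesis using v(2) vv nw by simp
  qed
  thus ?thesis using v(1) by (simp add: rayleigh_argmax_def)
qed

section \<open>Quadratic growth in the angle and its stability\<close>

text \<open>By concavity on [0, pi/2] the sine lies above its chord between the end points.\<close>

lemma jordan_sin_inequality:
  assumes "0 \<le> x" "x \<le> pi / 2"
  shows "2 / pi * x \<le> sin x"
proof -
  have "concave_on {0..pi/2} sin"
    by (rule f''_le0_imp_concave[where f' = cos and f'' = "\<lambda>x. - sin x"])
      (auto intro!: derivative_eq_intros sin_ge_zero)
  from concave_onD[OF this, of "x / (pi / 2)" 0 "pi / 2"] assms
  show ?thesis by (simp add: field_simps)
qed

text \<open>Write \<phi> = c v + w with w orthogonal to v. The cross term vanishes by the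
  first-order condition, so the deficit is at least G (1 - c^2) = G sin^2 \<theta>, and Jordan's
  inequality gives sin \<theta> at least 2 \<theta> / pi. Finally \<theta> dominates the distance to
  the set of maximisers.\<close>

lemma rayleigh_quadratic_growth:
  fixes A :: "real ^ 'd ^ 'd"
  assumes sym: "transpose A = A" and v: "v \<in> rayleigh_argmax A" and G: "G \<ge> 0"
    and gap: "\<And>w. norm w = 1 \<Longrightarrow> v \<bullet> w = 0 \<Longrightarrow> w \<bullet> (A *v w) \<le> v \<bullet> (A *v v) - G"
    and \<phi>: "norm \<phi> = 1"
  shows "4 / pi\<^sup>2 * G * (INF \<psi>\<in>rayleigh_argmax A. arccos (\<phi> \<bullet> \<psi>))\<^sup>2
           \<le> v \<bullet> (A *v v) - \<phi> \<bullet> (A *v \<phi>)"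
proof -
  define c where "c = v \<bullet> \<phi>"
  define w where "w = \<phi> - c *\<^sub>R v"
  \<comment> \<open>The absolute value is available because both v and -v are maximisers. It brings
    \<theta> into [0, pi/2], where Jordan's inequality applies, and \<theta> is the angle to
    whichever of the two is nearer.\<close>
  define \<theta> where "\<theta> = arccos \<bar>c\<bar>"
  have v1: "norm v = 1" "v \<bullet> v = 1" using v by (auto simp: rayleigh_argmax_def norm_eq_1)
  have c1: "\<bar>c\<bar> \<le> 1" using Cauchy_Schwarz_ineq2[of v \<phi>] v1 \<phi> by (simp add: c_def)
  have vw: "v \<bullet> w = 0" by (simp add: w_def inner_diff_right c_def v1)
  have \<phi>w: "\<phi> = c *\<^sub>R v + w" by (simp add: w_def)
  have "1 = (norm \<phi>)\<^sup>2" using \<phi> by simp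
  also have "\<dots> = c\<^sup>2 + (norm w)\<^sup>2"
    unfolding \<phi>w power2_norm_eq_inner using vw v1
    by (simp add: inner_simps inner_commute power2_eq_square)
  finally have nw: "(norm w)\<^sup>2 = 1 - c\<^sup>2" by simp
  have cross: "v \<bullet> (A *v w) = 0"
    by (rule rayleigh_max_orthogonal[OF sym subspace_UNIV _ v1(1) _ _ vw])
      (use v in \<open>auto simp: rayleigh_argmax_def\<close>)
  have "w \<bullet> (A *v w) \<le> (norm w)\<^sup>2 * (v \<bullet> (A *v v) - G)"
  proof (cases "w = 0")
    case False
    have "(1 / norm w) *\<^sub>R w \<bullet> (A *v ((1 / norm w) *\<^sub>R w)) \<le> v \<bullet> (A *v v) - G"
      using False vw by (intro gap) auto
    thus ?thesis using False by (simp add: matrix_vector_mult_scaleR field_simps power2_eq_square)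
  qed simp
  moreover have "\<phi> \<bullet> (A *v \<phi>) = c\<^sup>2 * (v \<bullet> (A *v v)) + w \<bullet> (A *v w)"
    unfolding \<phi>w using cross symmetric_inner_commute[OF sym, of w v]
    by (simp add: matrix_vector_right_distrib matrix_vector_mult_scaleR inner_simps power2_eq_square)
  ultimately have low: "(1 - c\<^sup>2) * G \<le> v \<bullet> (A *v v) - \<phi> \<bullet> (A *v \<phi>)"
    by (simp add: nw algebra_simps)
  have \<theta>: "0 \<le> \<theta>" "\<theta> \<le> pi / 2"
    using c1 arccos_le_pi2[of "\<bar>c\<bar>"] by (auto simp: \<theta>_def arccos_lbound)
  have inner_le: "\<bar>\<phi> \<bullet> \<psi>\<bar> \<le> 1" if "\<psi> \<in> rayleigh_argmax A" for \<psi>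
    using Cauchy_Schwarz_ineq2[of \<phi> \<psi>] \<phi> that by (auto simp: rayleigh_argmax_def)
  have ge0: "0 \<le> arccos (\<phi> \<bullet> \<psi>)" if "\<psi> \<in> rayleigh_argmax A" for \<psi>
    using inner_le[OF that] by (auto intro!: arccos_lbound)
  let ?d = "INF \<psi>\<in>rayleigh_argmax A. arccos (\<phi> \<bullet> \<psi>)"
  have "\<exists>u\<in>rayleigh_argmax A. arccos (\<phi> \<bullet> u) = \<theta>"
    using v uminus_rayleigh_argmax[OF v]
    by (cases "c \<ge> 0") (auto simp: \<theta>_def c_def inner_commute intro: bexI[of _ v] bexI[of _ "- v"])
  then obtain u where u: "u \<in> rayleigh_argmax A" "arccos (\<phi> \<bullet> u) = \<theta>" by blast
  have "?d \<le> arccos (\<phi> \<bullet> u)"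
    using u(1) ge0 by (intro cINF_lower bdd_belowI2[where m = 0]) auto
  moreover have "0 \<le> ?d" using rayleigh_argmax_nonempty ge0 by (intro cINF_greatest)
  ultimately have "?d\<^sup>2 \<le> \<theta>\<^sup>2" using u(2) by (intro power_mono) auto
  moreover have "(2 / pi * \<theta>)\<^sup>2 \<le> (sin \<theta>)\<^sup>2"
    using jordan_sin_inequality[OF \<theta>] \<theta> by (intro power_mono) auto
  moreover have "(sin \<theta>)\<^sup>2 = 1 - c\<^sup>2"
    using c1 by (simp add: \<theta>_def sin_squared_eq)
  ultimately have "4 / pi\<^sup>2 * ?d\<^sup>2 \<le> 1 - c\<^sup>2"
    by (simp add: power_mult_distrib power_divide field_simps)
  from mult_right_mono[OF this G] low show ?thesis by (simp add: mult_ac)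
qed

text \<open>A Courant-Fischer argument in the plane spanned by u and w. The plane contains a unit
  vector x orthogonal to v, whose \<open>A\<close>-form is at most l2 + \<delta>. The form of
  \<open>A\<close> is diagonal in (u, w) with w carrying the smaller value, so w also has value at
  most l2 + \<delta>. The value at u is at least that at v, hence at least l1 - \<delta>. Each of
  the two comparisons costs one \<delta>.\<close>

lemma perturbed_spectral_gap:
  fixes A B :: "real ^ 'd ^ 'd"
  assumes sym: "transpose A = A" and near: "norm (A - B) \<le> \<delta>"
    and v: "norm v = 1" "v \<bullet> (B *v v) = l1"
    and gap: "\<And>u. v \<bullet> u = 0 \<Longrightarrow> u \<bullet> (B *v u) \<le> l2 * (norm u)\<^sup>2"
    and u: "u \<in> rayleigh_argmax A" and w: "norm w = 1" "u \<bullet> w = 0"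
  shows "w \<bullet> (A *v w) \<le> u \<bullet> (A *v u) - (l1 - l2 - 2 * \<delta>)"
proof -
  have u1: "norm u = 1" using u by (simp add: rayleigh_argmax_def)
  have max: "x \<bullet> (A *v x) \<le> u \<bullet> (A *v u)" if "norm x = 1" for x
    using that u by (simp add: rayleigh_argmax_def)
  have diff: "\<bar>x \<bullet> (A *v x) - x \<bullet> (B *v x)\<bar> \<le> \<delta>" if "norm x = 1" for x
    using abs_rayleigh_le[of x "A - B"] near that
    by (simp add: matrix_vector_mult_diff_rdistrib inner_diff_right)
  have cross: "u \<bullet> (A *v w) = 0" "w \<bullet> (A *v u) = 0"
    using rayleigh_max_orthogonal[OF sym subspace_UNIV _ u1 max _ w(2)]
      symmetric_inner_commute[OF sym, of w u] by auto
  have ww: "w \<bullet> w = 1" "u \<bullet> u = 1" "w \<bullet> u = 0"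
    using w u1 by (auto simp: norm_eq_1 inner_commute)
  \<comment> \<open>Coefficients of a unit vector of the plane orthogonal to v: the pair (v.w, -v.u)
    normalised, or u itself when it is already orthogonal to v.\<close>
  obtain a b where ab: "a\<^sup>2 + b\<^sup>2 = 1" "a * (v \<bullet> u) + b * (v \<bullet> w) = 0"
  proof (cases "v \<bullet> u = 0")
    case True thus ?thesis using that[of 1 0] by simp
  next
    case False
    define r where "r = sqrt ((v \<bullet> w)\<^sup>2 + (v \<bullet> u)\<^sup>2)"
    have r: "r > 0" "r\<^sup>2 = (v \<bullet> w)\<^sup>2 + (v \<bullet> u)\<^sup>2"
      using False by (auto simp: r_def sum_power2_gt_zero_iff)
    have "((v \<bullet> w) / r)\<^sup>2 + (- (v \<bullet> u) / r)\<^sup>2 = ((v \<bullet> w)\<^sup>2 + (v \<bullet> u)\<^sup>2) / r\<^sup>2"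
      by (simp add: power_divide add_divide_distrib)
    also have "\<dots> = 1" using r(1) by (simp only: r(2)[symmetric]) simp
    finally have "((v \<bullet> w) / r)\<^sup>2 + (- (v \<bullet> u) / r)\<^sup>2 = 1" .
    moreover have "(v \<bullet> w) / r * (v \<bullet> u) + - (v \<bullet> u) / r * (v \<bullet> w) = 0" by simp
    ultimately show ?thesis by (rule that)
  qed
  define x where "x = a *\<^sub>R u + b *\<^sub>R w"
  have x1: "norm x = 1"
    using ab ww by (simp add: x_def norm_eq_1 inner_simps power2_eq_square w(2))
  have vx: "v \<bullet> x = 0" using ab by (simp add: x_def inner_simps)
  have "x \<bullet> (A *v x) = a\<^sup>2 * (u \<bullet> (A *v u)) + b\<^sup>2 * (w \<bullet> (A *v w))"
    using cross by (simp add: x_def matrix_vector_right_distrib matrix_vector_mult_scaleR inner_simps power2_eq_square)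
  moreover have "a\<^sup>2 * (w \<bullet> (A *v w)) \<le> a\<^sup>2 * (u \<bullet> (A *v u))"
    using max[OF w(1)] by (intro mult_left_mono) auto
  moreover have "w \<bullet> (A *v w) = a\<^sup>2 * (w \<bullet> (A *v w)) + b\<^sup>2 * (w \<bullet> (A *v w))"
    using ab(1) by (metis distrib_right mult_1)
  ultimately have "w \<bullet> (A *v w) \<le> x \<bullet> (A *v x)" by linarith
  also have "\<dots> \<le> l2 + \<delta>" using diff[OF x1] gap[OF vx] x1 by simp
  finally have "w \<bullet> (A *v w) \<le> l2 + \<delta>" .
  moreover have "l1 - \<delta> \<le> u \<bullet> (A *v u)" using diff[OF v(1)] v(2) max[OF v(1)] by linarith
  ultimately show ?thesis by linarith
qed

text \<open>The complement is the set of matrices having some maximiser that violates the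
  inequality. It is the projection of a closed set of pairs (maximiser, matrix) along the compact
  sphere, hence closed.\<close>

lemma open_rayleigh_gap_below_angle:
  assumes \<phi>: "norm (\<phi> :: real ^ 'd) = 1"
  shows "open {A. \<forall>\<psi>\<in>rayleigh_argmax A. \<psi> \<bullet> (A *v \<psi>) - \<phi> \<bullet> (A *v \<phi>) < k * (arccos (\<phi> \<bullet> \<psi>))\<^sup>2}"
proof -
  let ?S = "sphere 0 1 \<times> UNIV :: ((real ^ 'd) \<times> (real ^ 'd ^ 'd)) set"
  let ?T = "{p. \<forall>\<psi>\<in>sphere 0 1. \<psi> \<bullet> (snd p *v \<psi>) \<le> fst p \<bullet> (snd p *v fst p)}"
  let ?U = "{p \<in> ?S. k * (arccos (\<phi> \<bullet> fst p))\<^sup>2 \<le> fst p \<bullet> (snd p *v fst p) - \<phi> \<bullet> (snd p *v \<phi>)}"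
  have "\<bar>\<phi> \<bullet> \<psi>\<bar> \<le> 1" if "norm \<psi> = 1" for \<psi>
    using Cauchy_Schwarz_ineq2[of \<phi> \<psi>] \<phi> that by auto
  hence b: "\<forall>p\<in>?S. - 1 \<le> \<phi> \<bullet> fst p \<and> \<phi> \<bullet> fst p \<le> 1" by (auto simp: abs_le_iff)
  have "closed ?U"
    unfolding inner_outer[symmetric]
    by (intro continuous_on_closed_Collect_le
        closed_Times closed_sphere closed_UNIV continuous_intros b)
  hence "closed (?T \<inter> ?U)" using closed_rayleigh_argmax_graph by blast
  from closed_compact_projection[OF compact_sphere this, of 0 1]
  have "closed (- {A. \<forall>\<psi>\<in>rayleigh_argmax A. \<psi> \<bullet> (A *v \<psi>) - \<phi> \<bullet> (A *v \<phi>) < k * (arccos (\<phi> \<bullet> \<psi>))\<^sup>2})"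
    by (rule back_subst[of closed]) (auto simp: rayleigh_argmax_def not_less)
  thus ?thesis by (simp add: closed_open)
qed

section \<open>Measurable selection of a maximiser\<close>

text \<open>Compact-valued maps whose hitting sets of closed sets are measurable: this property survives
  minimising a continuous function over the values, so minimising the coordinates one after the
  other ends with a measurable singleton.\<close>

definition measurable_compact_family :: "'x measure \<Rightarrow> ('x \<Rightarrow> 'm::topological_space set) \<Rightarrow> bool" where
  "measurable_compact_family M S \<longleftrightarrow>
     (\<forall>x\<in>space M. compact (S x) \<and> S x \<noteq> {}) \<and>
     (\<forall>C. closed C \<longrightarrow> {x \<in> space M. S x \<inter> C \<noteq> {}} \<in> sets M)"

text \<open>Some minimiser of h lies in C exactly when \<open>S x\<close> meets C and, for every
  rational q, the set \<open>S x\<close> meets C inside the sublevel {h <= q} whenever it meets that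
  sublevel at all. This expresses the hitting event through countably many hitting events of
  \<open>S\<close>.\<close>

lemma measurable_compact_family_argmin:
  fixes h :: "'m::t2_space \<Rightarrow> real"
  assumes S: "measurable_compact_family M S" and h: "continuous_on UNIV h"
  shows "measurable_compact_family M (\<lambda>x. {\<phi> \<in> S x. \<forall>\<psi>\<in>S x. h \<phi> \<le> h \<psi>})"
    (is "measurable_compact_family M ?T")
  unfolding measurable_compact_family_def
proof (intro conjI ballI allI impI)
  fix x assume x: "x \<in> space M"
  have cpt: "compact (S x)" "S x \<noteq> {}" using S x by (auto simp: measurable_compact_family_def)
  have "?T x = S x \<inter> {\<phi>. \<forall>\<psi>. \<psi> \<in> S x \<longrightarrow> h \<phi> \<le> h \<psi>}" by auto
  also have "compact \<dots>"
    by (intro compact_Int_closed cpt closed_Collect_all closed_Collect_imp closed_Collect_le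
        h continuous_on_const) auto
  finally show "compact (?T x)" .
  show "?T x \<noteq> {}"
    using continuous_attains_inf[OF cpt continuous_on_subset[OF h]] by auto
next
  fix C :: "'m set" assume C: "closed C"
  have cl: "closed {\<phi>. h \<phi> \<le> q}" for q by (intro closed_Collect_le h continuous_on_const)
  have eq: "{x \<in> space M. ?T x \<inter> C \<noteq> {}} = {x \<in> space M. S x \<inter> C \<noteq> {}} \<inter>
      (\<Inter>q\<in>\<rat>. (space M - {x \<in> space M. S x \<inter> {\<phi>. h \<phi> \<le> q} \<noteq> {}}) \<union>
         {x \<in> space M. S x \<inter> (C \<inter> {\<phi>. h \<phi> \<le> q}) \<noteq> {}})" (is "?L = ?R")
  proof (intro equalityI subsetI)
    fix x assume "x \<in> ?L"
    then obtain \<phi> where \<phi>: "x \<in> space M" "\<phi> \<in> S x" "\<phi> \<in> C" "\<And>\<psi>. \<psi> \<in> S x \<Longrightarrow> h \<phi> \<le> h \<psi>"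
      by blast
    have "S x \<inter> (C \<inter> {\<phi>. h \<phi> \<le> q}) \<noteq> {}" if "S x \<inter> {\<phi>. h \<phi> \<le> q} \<noteq> {}" for q
    proof -
      from that obtain \<psi> where "\<psi> \<in> S x" "h \<psi> \<le> q" by blast
      hence "h \<phi> \<le> q" using \<phi>(4) order_trans by blast
      thus ?thesis using \<phi> by blast
    qed
    thus "x \<in> ?R" using \<phi>(1-3) by blast
  next
    fix x assume x: "x \<in> ?R"
    hence xM: "x \<in> space M" and ne: "S x \<inter> C \<noteq> {}"
      and rat: "\<And>q. q \<in> \<rat> \<Longrightarrow> S x \<inter> {\<phi>. h \<phi> \<le> q} \<noteq> {} \<Longrightarrow> S x \<inter> (C \<inter> {\<phi>. h \<phi> \<le> q}) \<noteq> {}"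
      by blast+
    have "compact (S x \<inter> C)" using S xM C by (auto simp: measurable_compact_family_def compact_Int_closed)
    from continuous_attains_inf[OF this ne continuous_on_subset[OF h]]
    obtain \<phi> where \<phi>: "\<phi> \<in> S x" "\<phi> \<in> C" "\<And>\<psi>. \<psi> \<in> S x \<Longrightarrow> \<psi> \<in> C \<Longrightarrow> h \<phi> \<le> h \<psi>" by auto
    \<comment> \<open>If the minimum over \<open>S x\<close> were strictly below the minimum over
      its part in C, a rational q in between would contradict the condition for q.\<close>
    have "h \<phi> \<le> h \<psi>" if "\<psi> \<in> S x" for \<psi>
    proof (rule ccontr)
      assume "\<not> h \<phi> \<le> h \<psi>"
      then obtain q where q: "q \<in> \<rat>" "h \<psi> < q" "q < h \<phi>" using Rats_dense_in_real by (metis not_le)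
      hence "S x \<inter> {\<phi>. h \<phi> \<le> q} \<noteq> {}" using that by force
      from rat[OF q(1) this] show False using \<phi>(3) q(3) by force
    qed
    thus "x \<in> ?L" using xM \<phi> by blast
  qed
  have m: "{x \<in> space M. S x \<inter> D \<noteq> {}} \<in> sets M" if "closed D" for D
    using S that by (simp add: measurable_compact_family_def)
  show "{x \<in> space M. ?T x \<inter> C \<noteq> {}} \<in> sets M"
    unfolding eq
  proof (intro sets.Int sets.countable_INT' countable_rat m C image_subsetI)
    show "\<rat> \<noteq> ({} :: real set)" by auto
  next
    fix q :: real
    show "(space M - {x \<in> space M. S x \<inter> {\<phi>. h \<phi> \<le> q} \<noteq> {}}) \<union>
         {x \<in> space M. S x \<inter> (C \<inter> {\<phi>. h \<phi> \<le> q}) \<noteq> {}} \<in> sets M"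
      by (intro sets.Un sets.Diff sets.top m closed_Int C cl)
  qed
qed

text \<open>Minimising all coordinates in turn leaves points agreeing in every coordinate, that is,
  one point for each x. This lexicographic minimiser is the selection.\<close>

theorem measurable_compact_family_selection:
  fixes S :: "'x \<Rightarrow> 'm::euclidean_space set"
  assumes S: "measurable_compact_family M S"
  obtains f where "f \<in> borel_measurable M" "\<And>x. x \<in> space M \<Longrightarrow> f x \<in> S x"
proof -
  have "\<exists>T. measurable_compact_family M T \<and> (\<forall>x. T x \<subseteq> S x) \<and>
      (\<forall>x. \<forall>\<phi>\<in>T x. \<forall>\<psi>\<in>T x. \<forall>b\<in>B. \<phi> \<bullet> b = \<psi> \<bullet> b)" if "finite B" for B :: "'m set"
    using that
  proof induction
    case empty thus ?case using S by auto
  next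
    case (insert b B)
    then obtain T where T: "measurable_compact_family M T" "\<forall>x. T x \<subseteq> S x"
      "\<forall>x. \<forall>\<phi>\<in>T x. \<forall>\<psi>\<in>T x. \<forall>b\<in>B. \<phi> \<bullet> b = \<psi> \<bullet> b" by blast
    let ?T = "\<lambda>x. {\<phi> \<in> T x. \<forall>\<psi>\<in>T x. \<phi> \<bullet> b \<le> \<psi> \<bullet> b}"
    show ?case
    proof (intro exI[of _ ?T] conjI)
      show "measurable_compact_family M ?T"
        by (intro measurable_compact_family_argmin T continuous_intros)
      show "\<forall>x. ?T x \<subseteq> S x" using T(2) by blast
      show "\<forall>x. \<forall>\<phi>\<in>?T x. \<forall>\<psi>\<in>?T x. \<forall>c\<in>insert b B. \<phi> \<bullet> c = \<psi> \<bullet> c"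
        using T(3) by (auto intro: antisym)
    qed
  qed
  from this[OF finite_Basis] obtain T where T: "measurable_compact_family M T" "\<forall>x. T x \<subseteq> S x"
    and same: "\<forall>x. \<forall>\<phi>\<in>T x. \<forall>\<psi>\<in>T x. \<forall>b\<in>Basis. \<phi> \<bullet> b = \<psi> \<bullet> b"
    by blast
  have unique: "\<phi> = \<psi>" if "\<phi> \<in> T x" "\<psi> \<in> T x" for x \<phi> \<psi>
    by (rule euclidean_eqI) (use same that in blast)
  define f where "f x = (SOME \<phi>. \<phi> \<in> T x)" for x
  have f: "f x \<in> T x" if "x \<in> space M" for x
    using T(1) that by (simp add: f_def measurable_compact_family_def some_in_eq)
  have "f \<in> borel_measurable M"
  proof (rule borel_measurableI)
    fix U :: "'m set" assume "open U"
    hence "{x \<in> space M. T x \<inter> - U \<noteq> {}} \<in> sets M"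
      using T(1) by (auto simp: measurable_compact_family_def closed_Compl)
    \<comment> \<open>Since \<open>T x\<close> consists of f x alone, f x lies in U exactly when
      \<open>T x\<close> misses the closed complement of U.\<close>
    hence "space M - {x \<in> space M. T x \<inter> - U \<noteq> {}} \<in> sets M" by blast
    also have "space M - {x \<in> space M. T x \<inter> - U \<noteq> {}} = f -` U \<inter> space M"
      using f unique by blast
    finally show "f -` U \<inter> space M \<in> sets M" .
  qed
  thus ?thesis using that f T(2) by blast
qed

text \<open>For closed C, the matrices with a maximiser in C form the projection of the closed graph
  along the compact part of C on the sphere, so the hitting sets are even closed.\<close>

lemma measurable_leading_eigenvector:
  obtains f :: "real ^ 'd ^ 'd \<Rightarrow> real ^ 'd"
  where "f \<in> borel_measurable borel" "\<And>A. f A \<in> rayleigh_argmax A"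
proof -
  have "closed {A :: real ^ 'd ^ 'd. rayleigh_argmax A \<inter> C \<noteq> {}}" if "closed C" for C
  proof -
    let ?T = "{p. \<forall>\<psi>\<in>sphere 0 1. \<psi> \<bullet> (snd p *v \<psi>) \<le> fst p \<bullet> (snd p *v fst p)}"
    have "compact (sphere 0 1 \<inter> C)" using that by (intro compact_Int_closed) auto
    from closed_compact_projection[OF this closed_rayleigh_argmax_graph]
    show ?thesis by (rule back_subst[of closed]) (auto simp: rayleigh_argmax_def)
  qed
  hence "measurable_compact_family borel (rayleigh_argmax :: real ^ 'd ^ 'd \<Rightarrow> _)"
    using compact_rayleigh_argmax rayleigh_argmax_nonempty
    by (auto simp: measurable_compact_family_def)
  from measurable_compact_family_selection[OF this] show ?thesis using that by auto
qed

section \<open>Bernstein's inequality in Hilbert space\<close>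

lemma power_chord_le:
  fixes x y t :: real
  assumes "0 \<le> x" "0 \<le> y" "0 \<le> t" "t \<le> 1"
  shows "((1 - t) * x + t * y) ^ k \<le> (1 - t) * x ^ k + t * y ^ k"
proof -
  have "convex_on {0..} (\<lambda>x::real. x ^ k)"
    by (cases "even k") (auto intro: convex_power_odd convex_on_subset[OF convex_power_even])
  from convex_onD[OF this, of t x y] show ?thesis using assms by simp
qed

text \<open>The composition of cosh with the square root is the power series of x^k / (2k)!. Its
  coefficients are nonnegative, so convexity on the half line is inherited term by term.\<close>

lemma cosh_sqrt_chord_le:
  fixes x y t :: real
  assumes "0 \<le> x" "0 \<le> y" "0 \<le> t" "t \<le> 1"
  shows "cosh (sqrt ((1 - t) * x + t * y)) \<le> (1 - t) * cosh (sqrt x) + t * cosh (sqrt y)"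
proof (rule sums_le)
  let ?c = "\<lambda>z n. if even n then sqrt z ^ n /\<^sub>R fact n else 0"
  show "?c ((1 - t) * x + t * y) sums cosh (sqrt ((1 - t) * x + t * y))" by (rule cosh_converges)
  show "(\<lambda>n. (1 - t) * ?c x n + t * ?c y n) sums ((1 - t) * cosh (sqrt x) + t * cosh (sqrt y))"
    by (intro sums_add sums_mult cosh_converges)
  fix n
  show "?c ((1 - t) * x + t * y) n \<le> (1 - t) * ?c x n + t * ?c y n"
  proof (cases "even n")
    case True
    then obtain k where n: "n = 2 * k" by blast
    have p: "sqrt z ^ n = z ^ k" if "z \<ge> 0" for z using that by (simp add: n power_mult)
    have "?c ((1 - t) * x + t * y) n = ((1 - t) * x + t * y) ^ k / fact n"
      using True p[of "(1 - t) * x + t * y"] assms by (simp add: divide_inverse)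
    also have "\<dots> \<le> ((1 - t) * x ^ k + t * y ^ k) / fact n"
      by (intro divide_right_mono power_chord_le assms) simp
    also have "\<dots> = (1 - t) * ?c x n + t * ?c y n"
      using True p[OF assms(1)] p[OF assms(2)] by (simp add: divide_inverse algebra_simps)
    finally show ?thesis .
  qed simp
qed

text \<open>By the addition formulas and exp b = cosh b + sinh b, the right side minus the left is
  (cosh a - sinh a) (sinh b - b) in the first case and (cosh a + sinh a) (sinh b - b) in the second,
  both nonnegative.\<close>

lemma cosh_add_le:
  fixes a b :: real
  assumes "a \<ge> 0" "b \<ge> 0"
  shows "cosh (a + b) \<le> cosh a + b * sinh a + cosh a * (exp b - 1 - b)"
    and "cosh (a - b) \<le> cosh a - b * sinh a + cosh a * (exp b - 1 - b)"
proof -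
  have b: "b \<le> sinh b" using real_le_x_sinh[OF assms(2)] by (simp add: sinh_def exp_minus)
  have "\<bar>sinh a\<bar> \<le> cosh a" using sinh_less_cosh_real[of a] assms by simp
  hence s: "sinh a * (sinh b - b) \<le> cosh a * (sinh b - b)" "- sinh a * (sinh b - b) \<le> cosh a * (sinh b - b)"
    using mult_right_mono[of "sinh a" "cosh a" "sinh b - b"]
      mult_right_mono[of "- sinh a" "cosh a" "sinh b - b"] b by linarith+
  have e: "exp b = cosh b + sinh b" by (simp add: cosh_plus_sinh)
  show "cosh (a + b) \<le> cosh a + b * sinh a + cosh a * (exp b - 1 - b)"
    "cosh (a - b) \<le> cosh a - b * sinh a + cosh a * (exp b - 1 - b)"
    using s unfolding e by (simp_all add: cosh_add cosh_diff algebra_simps)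
qed

text \<open>For fixed norms of \<open>u\<close> and \<open>x\<close> the left-hand side is convex and the right-hand side affine
  in \<open>u \<bullet> x\<close>, so it suffices to compare them when \<open>u\<close> and \<open>x\<close> are parallel.\<close>

lemma cosh_norm_add_le:
  fixes u x :: "'a::real_inner"
  shows "cosh (norm (u + x))
     \<le> cosh (norm u) + sinh (norm u) / norm u * (u \<bullet> x) + cosh (norm u) * (exp (norm x) - 1 - norm x)"
proof (cases "u = 0 \<or> x = 0")
  case True
  \<comment> \<open>At u = 0 the quotient by the norm is 0 by convention, harmlessly, because it
    multiplies a vanishing inner product.\<close>
  thus ?thesis using cosh_add_le(1)[of 0 "norm x"] by auto
next
  case False
  define a b c where "a = norm u" and "b = norm x" and "c = u \<bullet> x"
  \<comment> \<open>The weight that writes the inner product c as a mixture of its two extreme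
    values -ab and ab.\<close>
  define t where "t = (c + a * b) / (2 * (a * b))"
  have ab: "a > 0" "b > 0" using False by (auto simp: a_def b_def)
  have "\<bar>c\<bar> \<le> a * b" using Cauchy_Schwarz_ineq2[of u x] by (simp add: a_def b_def c_def)
  hence t: "0 \<le> t" "t \<le> 1" using ab by (auto simp: t_def field_simps abs_le_iff)
  have c: "c = (2 * t - 1) * (a * b)" using ab by (simp add: t_def field_simps)
  have "(norm (u + x))\<^sup>2 = a\<^sup>2 + 2 * c + b\<^sup>2"
    unfolding a_def b_def c_def power2_norm_eq_inner by (simp add: inner_simps inner_commute)
  also have "\<dots> = (1 - t) * (a - b)\<^sup>2 + t * (a + b)\<^sup>2"
    unfolding c by (simp add: power2_eq_square algebra_simps)
  finally have "norm (u + x) = sqrt ((1 - t) * (a - b)\<^sup>2 + t * (a + b)\<^sup>2)"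
    by (metis norm_ge_zero real_sqrt_unique)
  hence "cosh (norm (u + x)) \<le> (1 - t) * cosh (a - b) + t * cosh (a + b)"
    using cosh_sqrt_chord_le[of "(a - b)\<^sup>2" "(a + b)\<^sup>2" t] t by simp
  also have "\<dots> \<le> (1 - t) * (cosh a - b * sinh a + cosh a * (exp b - 1 - b))
      + t * (cosh a + b * sinh a + cosh a * (exp b - 1 - b))"
    using cosh_add_le[of a b] ab t by (intro add_mono mult_left_mono) auto
  also have "\<dots> = cosh a + sinh a / a * c + cosh a * (exp b - 1 - b)"
    using ab unfolding c by (simp add: field_simps)
  finally show ?thesis by (simp add: a_def b_def c_def)
qed

section \<open>Exponential moments and tails of independent sums\<close>

context prob_space
begin

text \<open>After averaging, the term linear in the increment disappears because the mean is zero,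
  so adding one increment costs at most a factor 1 + e, whatever the dimension.\<close>

lemma nn_integral_cosh_norm_add_le:
  fixes \<xi> :: "'a \<Rightarrow> 'b::euclidean_space"
  assumes [measurable]: "\<xi> \<in> borel_measurable M"
    and int: "integrable M (\<lambda>x. exp (norm (\<xi> x)))"
    and mean: "expectation \<xi> = 0"
    and e: "expectation (\<lambda>x. exp (norm (\<xi> x)) - 1 - norm (\<xi> x)) \<le> e"
  shows "(\<integral>\<^sup>+x. ennreal (cosh (norm (u + \<xi> x))) \<partial>M) \<le> ennreal ((1 + e) * cosh (norm u))"
proof -
  have le: "norm y \<le> exp (norm y)" for y :: 'b using exp_ge_add_one_self[of "norm y"] by linarith
  have \<xi>: "integrable M \<xi>" by (rule Bochner_Integration.integrable_bound[OF int]) (auto simp: le)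
  let ?g = "\<lambda>x. cosh (norm u) + sinh (norm u) / norm u * (u \<bullet> \<xi> x)
      + cosh (norm u) * (exp (norm (\<xi> x)) - 1 - norm (\<xi> x))"
  have int_g: "integrable M ?g" using \<xi> int by (intro Bochner_Integration.integrable_add integrable_mult_right
      Bochner_Integration.integrable_diff integrable_inner_right integrable_norm) auto
  have "(\<integral>\<^sup>+x. ennreal (cosh (norm (u + \<xi> x))) \<partial>M) \<le> (\<integral>\<^sup>+x. ennreal (?g x) \<partial>M)"
    by (intro nn_integral_mono ennreal_leI cosh_norm_add_le)
  also have "\<dots> = ennreal (expectation ?g)"
  proof (intro nn_integral_eq_integral int_g AE_I2)
    fix x show "0 \<le> ?g x" using cosh_norm_add_le[of u "\<xi> x"] cosh_real_pos[of "norm (u + \<xi> x)"] by linarith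
  qed
  also have "expectation ?g = cosh (norm u) + sinh (norm u) / norm u * (u \<bullet> expectation \<xi>)
      + cosh (norm u) * expectation (\<lambda>x. exp (norm (\<xi> x)) - 1 - norm (\<xi> x))"
    using \<xi> int by (simp add: prob_space)
  also have "\<dots> \<le> (1 + e) * cosh (norm u)"
    using mult_left_mono[OF e, of "cosh (norm u)"] by (simp add: mean algebra_simps)
  finally show ?thesis by (simp add: ennreal_leI)
qed

text \<open>Integrate out the last coordinate first, with the previous partial sum frozen as u. Each
  summand contributes one factor 1 + e, starting from cosh 0 = 1.\<close>

lemma nn_integral_cosh_norm_sum_le:
  fixes \<xi> :: "'a \<Rightarrow> 'b::euclidean_space"
  assumes [measurable]: "\<xi> \<in> borel_measurable M"
    and int: "integrable M (\<lambda>x. exp (norm (\<xi> x)))"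
    and mean: "expectation \<xi> = 0"
    and e: "expectation (\<lambda>x. exp (norm (\<xi> x)) - 1 - norm (\<xi> x)) \<le> e" and e0: "0 \<le> e"
  shows "(\<integral>\<^sup>+x. ennreal (cosh (norm (\<Sum>i<n. \<xi> (x i)))) \<partial>Pi\<^sub>M {..<n} (\<lambda>_. M)) \<le> ennreal ((1 + e) ^ n)"
proof (induction n)
  case 0
  interpret P: prob_space "Pi\<^sub>M {..<0::nat} (\<lambda>_. M)" by (intro prob_space_PiM prob_space_axioms)
  show ?case using P.emeasure_space_1 by simp
next
  case (Suc n)
  interpret product_sigma_finite "\<lambda>_::nat. M" ..
  have "(\<integral>\<^sup>+x. ennreal (cosh (norm (\<Sum>i<Suc n. \<xi> (x i)))) \<partial>Pi\<^sub>M {..<Suc n} (\<lambda>_. M)) =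
      (\<integral>\<^sup>+x. \<integral>\<^sup>+y. ennreal (cosh (norm (\<Sum>i<Suc n. \<xi> ((x(n := y)) i)))) \<partial>M \<partial>Pi\<^sub>M {..<n} (\<lambda>_. M))"
    unfolding lessThan_Suc cosh_def by (intro product_nn_integral_insert) (auto intro!: borel_measurable_sum)
  also have "\<dots> = (\<integral>\<^sup>+x. \<integral>\<^sup>+y. ennreal (cosh (norm ((\<Sum>i<n. \<xi> (x i)) + \<xi> y))) \<partial>M \<partial>Pi\<^sub>M {..<n} (\<lambda>_. M))"
    by simp
  also have "\<dots> \<le> (\<integral>\<^sup>+x. ennreal (1 + e) * ennreal (cosh (norm (\<Sum>i<n. \<xi> (x i)))) \<partial>Pi\<^sub>M {..<n} (\<lambda>_. M))"
    using nn_integral_cosh_norm_add_le[OF assms(1) int mean e] e0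
    by (intro nn_integral_mono) (simp add: ennreal_mult'')
  also have "\<dots> = ennreal (1 + e) * (\<integral>\<^sup>+x. ennreal (cosh (norm (\<Sum>i<n. \<xi> (x i)))) \<partial>Pi\<^sub>M {..<n} (\<lambda>_. M))"
    unfolding cosh_def by (intro nn_integral_cmult) (auto intro!: borel_measurable_sum)
  also have "\<dots> \<le> ennreal (1 + e) * ennreal ((1 + e) ^ n)" by (intro mult_left_mono Suc.IH) simp
  also have "\<dots> = ennreal ((1 + e) ^ Suc n)" using e0 by (simp add: ennreal_mult'')
  finally show ?case .
qed

text \<open>In the series of exp y - 1 - y the factorial in the moment hypothesis cancels the one in
  the denominator, leaving a geometric series in s R. The series starts at degree 2, where the
  moment hypothesis starts.\<close>

lemma exp_remainder_moment_bound:
  fixes X :: "'a \<Rightarrow> real"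
  assumes [measurable]: "X \<in> borel_measurable M" and X: "\<And>x. 0 \<le> X x"
    and mom: "\<And>p. p \<ge> 2 \<Longrightarrow> (\<integral>\<^sup>+x. ennreal (X x ^ p) \<partial>M) \<le> ennreal (fact p / 2 * R ^ p)"
    and lam: "0 \<le> s" "0 \<le> R" "s * R < 1"
  shows "integrable M (\<lambda>x. exp (s * X x))"
    and "expectation (\<lambda>x. exp (s * X x) - 1 - s * X x) \<le> (s * R)\<^sup>2 / (2 * (1 - s * R))"
proof -
  let ?h = "\<lambda>y::real. exp y - 1 - y"
  define B where "B = (s * R)\<^sup>2 / (2 * (1 - s * R))"
  have B0: "B \<ge> 0" using lam by (simp add: B_def)
  have h_sums: "(\<lambda>k. y ^ (k + 2) / fact (k + 2)) sums ?h y" for y :: real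
    using sums_split_initial_segment[OF exp_converges[of y], of 2]
    by (simp add: divide_inverse mult.commute numeral_2_eq_2 algebra_simps)
  have h0: "?h y \<ge> 0" for y using exp_ge_add_one_self[of y] by linarith
  have "(\<integral>\<^sup>+x. ennreal (?h (s * X x)) \<partial>M)
      = (\<integral>\<^sup>+x. (\<Sum>k. ennreal ((s * X x) ^ (k + 2) / fact (k + 2))) \<partial>M)"
    using h_sums X lam by (intro nn_integral_cong suminf_ennreal_eq[symmetric]) auto
  also have "\<dots> = (\<Sum>k. \<integral>\<^sup>+x. ennreal ((s * X x) ^ (k + 2) / fact (k + 2)) \<partial>M)"
    by (rule nn_integral_suminf) measurable
  also have "\<dots> \<le> (\<Sum>k. ennreal ((s * R)\<^sup>2 / 2 * (s * R) ^ k))"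
  proof (intro suminf_le summableI)
    fix k
    have "(\<integral>\<^sup>+x. ennreal ((s * X x) ^ (k + 2) / fact (k + 2)) \<partial>M)
        = (\<integral>\<^sup>+x. ennreal (s ^ (k + 2) / fact (k + 2)) * ennreal (X x ^ (k + 2)) \<partial>M)"
      using lam X by (intro nn_integral_cong) (simp add: ennreal_mult'[symmetric] power_mult_distrib field_simps)
    also have "\<dots> = ennreal (s ^ (k + 2) / fact (k + 2)) * (\<integral>\<^sup>+x. ennreal (X x ^ (k + 2)) \<partial>M)"
      by (rule nn_integral_cmult) measurable
    also have "\<dots> \<le> ennreal (s ^ (k + 2) / fact (k + 2)) * ennreal (fact (k + 2) / 2 * R ^ (k + 2))"
      by (intro mult_left_mono mom) auto
    also have "\<dots> = ennreal ((s * R)\<^sup>2 / 2 * (s * R) ^ k)"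
      using lam by (subst ennreal_mult'[symmetric]) (auto simp del: fact_Suc simp: power_add power_mult_distrib power2_eq_square)
    finally show "(\<integral>\<^sup>+x. ennreal ((s * X x) ^ (k + 2) / fact (k + 2)) \<partial>M) \<le> ennreal ((s * R)\<^sup>2 / 2 * (s * R) ^ k)" .
  qed
  also have "\<dots> = ennreal ((s * R)\<^sup>2 / 2 * (1 / (1 - s * R)))"
    using lam by (intro suminf_ennreal_eq sums_mult geometric_sums) auto
  finally have le: "(\<integral>\<^sup>+x. ennreal (?h (s * X x)) \<partial>M) \<le> ennreal B" by (simp add: B_def)
  have int_h: "integrable M (\<lambda>x. ?h (s * X x))"
    using le h0 by (intro integrableI_nonneg) (auto simp: le_less_trans)
  show "integrable M (\<lambda>x. exp (s * X x))"
  proof (rule Bochner_Integration.integrable_bound)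
    show "integrable M (\<lambda>x. 2 * ?h (s * X x) + 2)"
      using int_h by (intro Bochner_Integration.integrable_add integrable_mult_right) auto
    \<comment> \<open>This amounts to 2 y <= exp y. It transfers integrability from the remainder to
      the exponential.\<close>
    have "exp y \<le> 2 * ?h y + 2" if "y \<ge> 0" for y :: real
      using exp_lower_Taylor_quadratic[OF that] zero_le_power2[of "y - 1"] by (simp add: power2_eq_square algebra_simps)
    thus "AE x in M. norm (exp (s * X x)) \<le> norm (2 * ?h (s * X x) + 2)"
      using X lam h0 by (intro AE_I2) (smt (verit) mult_nonneg_nonneg real_norm_def exp_ge_zero)
  qed simp
  have "ennreal (expectation (\<lambda>x. ?h (s * X x))) \<le> ennreal B"
    using le nn_integral_eq_integral[OF int_h] h0 by simp
  thus "expectation (\<lambda>x. exp (s * X x) - 1 - s * X x) \<le> (s * R)\<^sup>2 / (2 * (1 - s * R))"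
    using B0 by (simp add: B_def ennreal_le_iff)
qed

text \<open>A Chernoff bound with cosh of the norm in place of exp. The prefactor 2 comes only from
  exp being at most 2 cosh.\<close>

theorem bernstein_norm_sum:
  fixes \<xi> :: "'a \<Rightarrow> 'b::euclidean_space"
  assumes [measurable]: "\<xi> \<in> borel_measurable M"
    and mean: "expectation \<xi> = 0"
    and mom: "\<And>p. p \<ge> 2 \<Longrightarrow> (\<integral>\<^sup>+x. ennreal (norm (\<xi> x) ^ p) \<partial>M) \<le> ennreal (fact p / 2 * R ^ p)"
    and R: "R > 0" and t: "t > 0"
  shows "measure (Pi\<^sub>M {..<n} (\<lambda>_. M)) {x \<in> space (Pi\<^sub>M {..<n} (\<lambda>_. M)). real n * t \<le> norm (\<Sum>i<n. \<xi> (x i))}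
     \<le> 2 * exp (- (t\<^sup>2 / (2 * (R\<^sup>2 + R * t))) * real n)"
proof -
  let ?P = "Pi\<^sub>M {..<n} (\<lambda>_. M)"
  interpret P: prob_space ?P by (intro prob_space_PiM prob_space_axioms)
  \<comment> \<open>With this choice l R = t / (R + t) is below 1 and e is exactly half of l t, so
    the exponent e - l t equals minus half of l t.\<close>
  define l where "l = t / (R\<^sup>2 + R * t)"
  define e where "e = (l * R)\<^sup>2 / (2 * (1 - l * R))"
  have l: "l > 0" using R t by (simp add: l_def add_pos_pos)
  have lR: "l * R = t / (R + t)" 
  proof -
    have "R\<^sup>2 + R * t = R * (R + t)" by (simp add: power2_eq_square algebra_simps)
    thus ?thesis using R by (simp add: l_def)
  qed
  have lR1: "l * R < 1" using R t by (simp add: lR)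
  have e0: "e \<ge> 0" using lR1 by (simp add: e_def)
  have exponent: "e - l * t = - (t\<^sup>2 / (2 * (R\<^sup>2 + R * t)))"
  proof -
    have 1: "1 - l * R = R / (R + t)" unfolding lR using R t by (simp add: field_simps)
    have "e = t\<^sup>2 / (2 * (R\<^sup>2 + R * t))"
    proof -
      have "(t / u)\<^sup>2 / (2 * (R / u)) = t\<^sup>2 / (2 * (R * u))" if "u > 0" for u
        using that R by (simp add: field_simps power2_eq_square)
      from this[of "R + t"] show ?thesis
        unfolding e_def 1 unfolding lR using R t by (simp add: distrib_left power2_eq_square)
    qed
    moreover have "l * t = 2 * (t\<^sup>2 / (2 * (R\<^sup>2 + R * t)))" by (simp add: l_def power2_eq_square del: distrib_left_numeral)
    ultimately show ?thesis by simp
  qed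
  have e_bounds: "integrable M (\<lambda>x. exp (l * norm (\<xi> x)))"
     "expectation (\<lambda>x. exp (l * norm (\<xi> x)) - 1 - l * norm (\<xi> x)) \<le> e"
    using exp_remainder_moment_bound[of "\<lambda>x. norm (\<xi> x)" R l] mom l R lR1 by (simp_all add: e_def)
  have mgf: "(\<integral>\<^sup>+x. ennreal (cosh (norm (\<Sum>i<n. l *\<^sub>R \<xi> (x i)))) \<partial>?P) \<le> ennreal ((1 + e) ^ n)"
    using e_bounds l e0 mean by (intro nn_integral_cosh_norm_sum_le) (simp_all)
  \<comment> \<open>Scaled so that \<open>c\<close> times the cosh is at least 1 on the tail event,
    as Markov's inequality needs.\<close>
  define c where "c = 2 * exp (- l * (real n * t))"
  let ?u = "\<lambda>x. ennreal (cosh (norm (\<Sum>i<n. l *\<^sub>R \<xi> (x i))))"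
  have meas: "(\<lambda>x. ?u x * indicator (space ?P) x) \<in> borel_measurable ?P"
    unfolding cosh_def by (auto intro!: borel_measurable_sum)
  have "emeasure ?P {x \<in> space ?P. real n * t \<le> norm (\<Sum>i<n. \<xi> (x i))}
      \<le> emeasure ?P {x \<in> space ?P. 1 \<le> ennreal c * ?u x}"
  proof (intro emeasure_mono subsetI CollectI conjI)
    fix x assume x: "x \<in> {x \<in> space ?P. real n * t \<le> norm (\<Sum>i<n. \<xi> (x i))}"
    thus "x \<in> space ?P" by simp
    let ?N = "norm (\<Sum>i<n. \<xi> (x i))"
    have N: "norm (\<Sum>i<n. l *\<^sub>R \<xi> (x i)) = l * ?N"
      using l by (simp add: scaleR_sum_right[symmetric])
    have "1 \<le> exp (- l * (real n * t)) * exp (l * ?N)"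
      using x l by (simp add: exp_add[symmetric])
    also have "\<dots> \<le> c * cosh (l * ?N)"
      by (simp add: c_def cosh_def)
    finally show "1 \<le> ennreal c * ?u x" unfolding N
      by (simp add: c_def ennreal_mult''[symmetric] cosh_real_nonneg)
  next
    show "{x \<in> space ?P. 1 \<le> ennreal c * ?u x} \<in> P.events"
      unfolding cosh_def by measurable
  qed
  also have "\<dots> \<le> ennreal c * (\<integral>\<^sup>+x. ?u x * indicator (space ?P) x \<partial>?P)"
    by (intro nn_integral_Markov_inequality meas sets.top)
  also have "\<dots> = ennreal c * (\<integral>\<^sup>+x. ?u x \<partial>?P)"
    by (intro arg_cong2[where f = "(*)"] nn_integral_cong) auto
  also have "\<dots> \<le> ennreal c * ennreal ((1 + e) ^ n)" by (intro mult_left_mono mgf) simp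
  also have "\<dots> = ennreal (c * (1 + e) ^ n)" using e0 by (simp add: c_def ennreal_mult'')
  finally have "measure ?P {x \<in> space ?P. real n * t \<le> norm (\<Sum>i<n. \<xi> (x i))} \<le> c * (1 + e) ^ n"
    using e0 by (simp add: P.emeasure_eq_measure c_def)
  also have "\<dots> \<le> c * exp e ^ n" using e0 by (intro mult_left_mono power_mono) (auto simp: c_def)
  also have "\<dots> = 2 * exp ((e - l * t) * real n)"
    by (simp add: c_def exp_of_nat_mult[symmetric] exp_add[symmetric] algebra_simps)
  finally show ?thesis by (simp add: exponent)
qed

end

section \<open>Subgaussian laws\<close>

lemma exp_ge_one_plus_power:
  fixes y :: real
  assumes "y \<ge> 0" "p \<ge> 1"
  shows "1 + y ^ p / fact p \<le> exp y"
proof -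
  have "(\<Sum>n\<in>{0, p}. y ^ n / fact n) \<le> exp y"
    using sum_le_suminf[of "\<lambda>n. y ^ n / fact n" "{0, p}"] exp_converges[of y] assms
    by (simp add: sums_iff divide_inverse mult.commute)
  thus ?thesis using assms by simp
qed

lemma psi_norm_2_less_imp:
  assumes "psi_norm 2 M Z < ennreal c"
  shows "(\<integral>\<^sup>+x. ennreal (exp ((Z x)\<^sup>2 / c\<^sup>2)) \<partial>M) \<le> 2" and "0 < c"
proof -
  obtain b where b: "ennreal b < ennreal c" "0 < b"
    "(\<integral>\<^sup>+x. ennreal (exp (\<bar>Z x\<bar> powr 2 / b powr 2)) \<partial>M) \<le> 2"
    using assms by (auto simp: psi_norm_def Inf_less_iff)
  hence bc: "b < c" by (simp add: ennreal_less_iff)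
  show "0 < c" using b bc by simp
  have "(Z x)\<^sup>2 / c\<^sup>2 \<le> \<bar>Z x\<bar> powr 2 / b powr 2" for x
    using b bc by (simp add: frac_le power_mono)
  hence "(\<integral>\<^sup>+x. ennreal (exp ((Z x)\<^sup>2 / c\<^sup>2)) \<partial>M) \<le> (\<integral>\<^sup>+x. ennreal (exp (\<bar>Z x\<bar> powr 2 / b powr 2)) \<partial>M)"
    by (intro nn_integral_mono ennreal_leI) simp
  thus "(\<integral>\<^sup>+x. ennreal (exp ((Z x)\<^sup>2 / c\<^sup>2)) \<partial>M) \<le> 2" using b(3) by (rule order_trans)
qed

text \<open>The infimum defining the norm is attained when positive: constants decreasing to K are
  admissible, and Fatou's lemma passes the bound 2 to the limit.\<close>

lemma psi_norm_2_admissible: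
  assumes [measurable]: "Z \<in> borel_measurable M" and le: "psi_norm 2 M Z \<le> ennreal K" and K: "K > 0"
  shows "(\<integral>\<^sup>+x. ennreal (exp ((Z x)\<^sup>2 / K\<^sup>2)) \<partial>M) \<le> 2"
proof -
  define c where "c n = K + 1 / real (Suc n)" for n
  let ?u = "\<lambda>n x. ennreal (exp ((Z x)\<^sup>2 / (c n)\<^sup>2))"
  have "(\<lambda>n. 1 / real (Suc n)) \<longlonglongrightarrow> 0" by (rule LIMSEQ_Suc[OF lim_1_over_n])
  hence "c \<longlonglongrightarrow> K" unfolding c_def[abs_def] by (auto intro: tendsto_eq_intros)
  hence "(\<lambda>n. ?u n x) \<longlonglongrightarrow> ennreal (exp ((Z x)\<^sup>2 / K\<^sup>2))" for x
    using K by (intro tendsto_intros) auto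
  hence lim: "liminf (\<lambda>n. ?u n x) = ennreal (exp ((Z x)\<^sup>2 / K\<^sup>2))" for x
    by (intro lim_imp_Liminf) auto
  have "(\<integral>\<^sup>+x. ennreal (exp ((Z x)\<^sup>2 / K\<^sup>2)) \<partial>M) \<le> liminf (\<lambda>n. \<integral>\<^sup>+x. ?u n x \<partial>M)"
    unfolding lim[symmetric] by (intro nn_integral_liminf) measurable
  also have "\<dots> \<le> liminf (\<lambda>n::nat. 2 :: ennreal)"
  proof (intro Liminf_mono always_eventually allI psi_norm_2_less_imp)
    fix n
    have "ennreal K < ennreal (c n)" using K by (simp add: c_def ennreal_less_iff)
    with le show "psi_norm 2 M Z < ennreal (c n)" by (rule le_less_trans)
  qed
  also have "\<dots> = 2" by (simp add: Liminf_const)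
  finally show ?thesis .
qed

text \<open>Every c > 0 is then admissible, and 1 + y <= exp y gives a second moment of at most c^2
  for all such c.\<close>

lemma psi_norm_2_eq_0_imp:
  assumes [measurable]: "Z \<in> borel_measurable M" and "prob_space M" and 0: "psi_norm 2 M Z = 0"
  shows "AE x in M. Z x = 0"
proof -
  interpret prob_space M by fact
  have bound: "(\<integral>\<^sup>+x. ennreal ((Z x)\<^sup>2) \<partial>M) \<le> ennreal (c\<^sup>2)" if "c > 0" for c
  proof -
    let ?I = "\<integral>\<^sup>+x. ennreal ((Z x)\<^sup>2 / c\<^sup>2) \<partial>M"
    have "1 + ?I = (\<integral>\<^sup>+x. 1 + ennreal ((Z x)\<^sup>2 / c\<^sup>2) \<partial>M)"
      by (subst nn_integral_add) (simp_all add: emeasure_space_1)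
    also have "\<dots> \<le> (\<integral>\<^sup>+x. ennreal (exp ((Z x)\<^sup>2 / c\<^sup>2)) \<partial>M)"
      by (intro nn_integral_mono) (simp add: ennreal_1[symmetric] ennreal_plus[symmetric] ennreal_leI exp_ge_add_one_self del: ennreal_1 ennreal_plus)
    also have "\<dots> \<le> 1 + 1" using psi_norm_2_less_imp(1)[of M Z c] 0 that by simp
    finally have "?I \<le> 1" by (simp add: ennreal_add_left_cancel_le del: one_add_one)
    have "(\<integral>\<^sup>+x. ennreal ((Z x)\<^sup>2) \<partial>M) = (\<integral>\<^sup>+x. ennreal (c\<^sup>2) * ennreal ((Z x)\<^sup>2 / c\<^sup>2) \<partial>M)"
      using that by (intro nn_integral_cong) (simp add: ennreal_mult'[symmetric])
    also have "\<dots> = ennreal (c\<^sup>2) * ?I" by (intro nn_integral_cmult) measurable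
    also have "\<dots> \<le> ennreal (c\<^sup>2) * 1" by (intro mult_left_mono \<open>?I \<le> 1\<close>) simp
    finally show ?thesis by simp
  qed
  have "(\<integral>\<^sup>+x. ennreal ((Z x)\<^sup>2) \<partial>M) \<le> 0"
  proof (rule ennreal_le_epsilon)
    fix e :: real assume "0 < e"
    thus "(\<integral>\<^sup>+x. ennreal ((Z x)\<^sup>2) \<partial>M) \<le> 0 + ennreal e" using bound[of "sqrt e"] by simp
  qed
  hence "(\<integral>\<^sup>+x. ennreal ((Z x)\<^sup>2) \<partial>M) = 0" by simp
  hence "AE x in M. ennreal ((Z x)\<^sup>2) = 0" by (subst (asm) nn_integral_0_iff_AE) auto
  thus ?thesis by eventually_elim (simp add: ennreal_eq_0_iff)
qed

lemma norm_vec_power2_eq_sum: "(norm x)\<^sup>2 = (\<Sum>i\<in>UNIV. (x $ i)\<^sup>2)" for x :: "real ^ 'd"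
  unfolding power2_norm_eq_inner inner_vec_def by (simp add: power2_eq_square)

section \<open>Moments of a subgaussian law and of its covariance\<close>

text \<open>The norm enters only through the exponential moment of every one-dimensional marginal at
  the scale \<open>K\<close>. The constant \<open>D\<close> plays the same role for the squared norm
  of the whole vector.\<close>

locale subgaussian_law = prob_space \<mu> for \<mu> :: "(real ^ 'd) measure" +
  fixes K D :: real
  assumes sets_law: "sets \<mu> = sets borel" and K_pos: "K > 0"
    and exp_moment: "norm v = 1 \<Longrightarrow> (\<integral>\<^sup>+x. ennreal (exp ((x \<bullet> v)\<^sup>2 / K\<^sup>2)) \<partial>\<mu>) \<le> 2"
    and D_eq: "D = real CARD('d) * K\<^sup>2"
begin

lemma borel_measurable_law [measurable (raw)]: "f \<in> borel_measurable borel \<Longrightarrow> f \<in> borel_measurable \<mu>"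
  using measurable_cong_sets[OF sets_law refl] by blast

lemma D_pos: "D > 0" using K_pos by (simp add: D_eq)

text \<open>The exponent is the average of the d squared coordinates divided by K^2, so convexity of
  exp reduces the bound to the coordinate axes.\<close>

lemma exp_moment_norm: "(\<integral>\<^sup>+x. ennreal (exp ((norm x)\<^sup>2 / D)) \<partial>\<mu>) \<le> 2"
proof -
  let ?d = "real CARD('d)"
  have "exp ((norm x)\<^sup>2 / D) \<le> (\<Sum>i\<in>UNIV. (1 / ?d) * exp ((x \<bullet> axis i 1)\<^sup>2 / K\<^sup>2))" for x :: "real ^ 'd"
  proof -
    have "(norm x)\<^sup>2 / D = (\<Sum>i\<in>UNIV. (1 / ?d) *\<^sub>R ((x \<bullet> axis i 1)\<^sup>2 / K\<^sup>2))"
      by (simp add: norm_vec_power2_eq_sum inner_axis sum_divide_distrib D_eq)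
    also have "exp \<dots> \<le> (\<Sum>i\<in>UNIV. (1 / ?d) * exp ((x \<bullet> axis i 1)\<^sup>2 / K\<^sup>2))"
      by (rule convex_on_sum[OF _ _ exp_convex]) auto
    finally show ?thesis .
  qed
  hence "(\<integral>\<^sup>+x. ennreal (exp ((norm x)\<^sup>2 / D)) \<partial>\<mu>)
      \<le> (\<integral>\<^sup>+x. ennreal (\<Sum>i\<in>UNIV. (1 / ?d) * exp ((x \<bullet> axis i 1)\<^sup>2 / K\<^sup>2)) \<partial>\<mu>)"
    by (intro nn_integral_mono ennreal_leI)
  also have "\<dots> = (\<integral>\<^sup>+x. (\<Sum>i\<in>UNIV. ennreal (1 / ?d) * ennreal (exp ((x \<bullet> axis i 1)\<^sup>2 / K\<^sup>2))) \<partial>\<mu>)"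
    by (intro nn_integral_cong) (simp add: sum_ennreal ennreal_mult'[symmetric])
  also have "\<dots> = (\<Sum>i\<in>UNIV. ennreal (1 / ?d) * (\<integral>\<^sup>+x. ennreal (exp ((x \<bullet> axis i 1)\<^sup>2 / K\<^sup>2)) \<partial>\<mu>))"
    by (subst nn_integral_sum) (auto intro!: sum.cong nn_integral_cmult)
  also have "\<dots> \<le> (\<Sum>i\<in>(UNIV :: 'd set). ennreal (1 / ?d) * 2)"
    by (intro sum_mono mult_left_mono exp_moment) auto
  also have "\<dots> = ennreal (?d * (1 / ?d)) * 2"
    by (simp add: ennreal_of_nat_eq_real_of_nat ennreal_mult'[symmetric] mult.assoc[symmetric])
  also have "\<dots> = 2" by simp
  finally show ?thesis .
qed

text \<open>Halving the exponent takes a square root, and the mean of a square root is at most the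
  root of the mean. This is obtained pointwise from AM-GM with equality at y = sqrt 2. Two
  independent factors will multiply to 2.\<close>

lemma exp_half_moment_norm: "(\<integral>\<^sup>+x. ennreal (exp ((norm x)\<^sup>2 / (2 * D))) \<partial>\<mu>) \<le> ennreal (sqrt 2)"
proof -
  let ?s = "1 / (2 * sqrt 2)"
  have am_gm: "y \<le> ?s * y\<^sup>2 + sqrt 2 / 2" for y :: real
  proof -
    have "0 \<le> (y - sqrt 2)\<^sup>2" by simp
    hence "2 * sqrt 2 * y \<le> y\<^sup>2 + 2" by (simp add: power2_diff algebra_simps)
    thus ?thesis by (simp add: field_simps)
  qed
  have "ennreal (exp ((norm x)\<^sup>2 / (2 * D))) \<le> ennreal ?s * ennreal (exp ((norm x)\<^sup>2 / D)) + ennreal (sqrt 2 / 2)"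
    for x :: "real ^ 'd"
  proof -
    have "(exp ((norm x)\<^sup>2 / (2 * D)))\<^sup>2 = exp ((norm x)\<^sup>2 / D)"
      by (simp add: power2_eq_square exp_add[symmetric] field_simps)
    thus ?thesis
      using am_gm[of "exp ((norm x)\<^sup>2 / (2 * D))"]
      by (simp add: ennreal_mult'[symmetric] ennreal_plus[symmetric] ennreal_leI del: ennreal_plus)
  qed
  hence "(\<integral>\<^sup>+x. ennreal (exp ((norm x)\<^sup>2 / (2 * D))) \<partial>\<mu>)
      \<le> (\<integral>\<^sup>+x. ennreal ?s * ennreal (exp ((norm x)\<^sup>2 / D)) + ennreal (sqrt 2 / 2) \<partial>\<mu>)"
    by (intro nn_integral_mono)
  also have "\<dots> = ennreal ?s * (\<integral>\<^sup>+x. ennreal (exp ((norm x)\<^sup>2 / D)) \<partial>\<mu>) + ennreal (sqrt 2 / 2)"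
    by (simp add: nn_integral_add nn_integral_cmult emeasure_space_1)
  also have "\<dots> \<le> ennreal ?s * ennreal 2 + ennreal (sqrt 2 / 2)"
    using exp_moment_norm by (intro add_mono mult_left_mono) auto
  also have "\<dots> = ennreal (?s * 2 + sqrt 2 / 2)"
    by (simp add: ennreal_mult'[symmetric] ennreal_plus[symmetric] del: ennreal_plus ennreal_numeral)
  also have "?s * 2 + sqrt 2 / 2 = sqrt 2" by (simp add: field_simps)
  finally show ?thesis .
qed

text \<open>Keeping the terms of degree 0 and p of the exponential series, the constant 1 is
  subtracted from the bound 2, so no factor 2 remains.\<close>

lemma norm_moment:
  assumes "p \<ge> 1"
  shows "(\<integral>\<^sup>+x. ennreal (((norm x)\<^sup>2) ^ p) \<partial>\<mu>) \<le> ennreal (fact p * D ^ p)"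
proof -
  let ?I = "\<integral>\<^sup>+x. ennreal (((norm x)\<^sup>2 / D) ^ p / fact p) \<partial>\<mu>"
  have "1 + ?I = (\<integral>\<^sup>+x. 1 + ennreal (((norm x)\<^sup>2 / D) ^ p / fact p) \<partial>\<mu>)"
    by (subst nn_integral_add) (simp_all add: emeasure_space_1)
  also have "\<dots> \<le> (\<integral>\<^sup>+x. ennreal (exp ((norm x)\<^sup>2 / D)) \<partial>\<mu>)"
  proof (intro nn_integral_mono)
    fix x
    have "1 + ennreal (((norm x)\<^sup>2 / D) ^ p / fact p) = ennreal (1 + ((norm x)\<^sup>2 / D) ^ p / fact p)"
      using D_pos by (subst ennreal_plus) auto
    also have "\<dots> \<le> ennreal (exp ((norm x)\<^sup>2 / D))"
      using assms D_pos by (intro ennreal_leI exp_ge_one_plus_power) auto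
    finally show "1 + ennreal (((norm x)\<^sup>2 / D) ^ p / fact p) \<le> ennreal (exp ((norm x)\<^sup>2 / D))" .
  qed
  also have "\<dots> \<le> 1 + 1" using exp_moment_norm by simp
  finally have I: "?I \<le> 1" by (simp add: ennreal_add_left_cancel_le del: one_add_one)
  have "(\<integral>\<^sup>+x. ennreal (((norm x)\<^sup>2) ^ p) \<partial>\<mu>)
      = (\<integral>\<^sup>+x. ennreal (fact p * D ^ p) * ennreal (((norm x)\<^sup>2 / D) ^ p / fact p) \<partial>\<mu>)"
    using D_pos by (intro nn_integral_cong) (simp add: ennreal_mult'[symmetric] power_divide)
  also have "\<dots> = ennreal (fact p * D ^ p) * ?I" by (intro nn_integral_cmult) measurable
  also have "\<dots> \<le> ennreal (fact p * D ^ p) * 1" by (intro mult_left_mono I) simp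
  finally show ?thesis by simp
qed

lemma borel_measurable_outer [measurable]: "outer \<in> borel_measurable borel"
  using continuous_on_outer[OF continuous_on_id] by (intro borel_measurable_continuous_onI) simp

lemma integrable_norm_power2: "integrable \<mu> (\<lambda>x. (norm x)\<^sup>2)"
  using norm_moment[of 1] by (intro integrableI_nonneg) (auto simp: le_less_trans)

lemma integrable_outer: "integrable \<mu> outer"
  by (rule Bochner_Integration.integrable_bound[OF integrable_norm_power2]) (auto simp: norm_outer)

lemma covariance_eq: "covariance \<mu> = expectation outer"
proof -
  have "expectation outer $ i $ j = (\<integral>x. x $ i * x $ j \<partial>\<mu>)" for i j
  proof -
    have "expectation outer $ i $ j = expectation outer \<bullet> axis i (axis j 1)"
      by (simp add: inner_axis)
    also have "\<dots> = (\<integral>x. outer x \<bullet> axis i (axis j 1) \<partial>\<mu>)"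
      by (rule integral_inner_left[symmetric]) (use integrable_outer in auto)
    finally show ?thesis by (simp add: inner_axis outer_def)
  qed
  thus ?thesis by (simp add: covariance_def vec_eq_iff)
qed

lemma norm_covariance_le: "norm (covariance \<mu>) \<le> D"
proof -
  have "norm (covariance \<mu>) \<le> expectation (\<lambda>x. (norm x)\<^sup>2)"
    unfolding covariance_eq using integral_norm_bound[of \<mu> outer] by (simp add: norm_outer)
  moreover have "ennreal (expectation (\<lambda>x. (norm x)\<^sup>2)) \<le> ennreal D"
    using norm_moment[of 1] nn_integral_eq_integral[OF integrable_norm_power2] by simp
  ultimately show ?thesis using D_pos by (simp add: ennreal_le_iff)
qed

lemma transpose_covariance: "transpose (covariance \<mu>) = covariance \<mu>"
  by (simp add: covariance_def transpose_def vec_eq_iff mult.commute)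

lemma rayleigh_covariance: "\<phi> \<bullet> (covariance \<mu> *v \<phi>) = expectation (\<lambda>x. (\<phi> \<bullet> x)\<^sup>2)"
proof -
  have "\<phi> \<bullet> (covariance \<mu> *v \<phi>) = expectation outer \<bullet> outer \<phi>"
    by (simp add: inner_outer covariance_eq)
  also have "\<dots> = (\<integral>x. outer x \<bullet> outer \<phi> \<partial>\<mu>)"
    by (intro integral_inner_left[symmetric] integrable_outer)
  finally show ?thesis by (simp add: inner_outer_outer inner_commute)
qed

lemma nn_integral_inner_power2:
  "(\<integral>\<^sup>+x. ennreal ((\<phi> \<bullet> x)\<^sup>2) \<partial>\<mu>) = ennreal (\<phi> \<bullet> (covariance \<mu> *v \<phi>))"
proof -
  have "integrable \<mu> (\<lambda>x. outer x \<bullet> outer \<phi>)" by (intro integrable_inner_left integrable_outer)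
  hence "integrable \<mu> (\<lambda>x. (\<phi> \<bullet> x)\<^sup>2)" by (simp add: inner_outer_outer inner_commute)
  thus ?thesis unfolding rayleigh_covariance by (intro nn_integral_eq_integral) auto
qed

text \<open>The centred norm is at most the squared norm of x plus \<open>D\<close>. Convexity of
  the p-th power splits the sum at the price 2^(p-1), and this price together with the extra D^p is
  absorbed into the factor e^p.\<close>

lemma centered_outer_moment:
  assumes p: "p \<ge> 2"
  shows "(\<integral>\<^sup>+x. ennreal (norm (outer x - covariance \<mu>) ^ p) \<partial>\<mu>)
     \<le> ennreal (fact p / 2 * (exp 1 * (real CARD('d) + 1) * K\<^sup>2) ^ p)"
proof -
  have pw: "norm (outer x - covariance \<mu>) ^ p \<le> 2 ^ p / 2 * (((norm x)\<^sup>2) ^ p + D ^ p)" for x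
  proof -
    have "norm (outer x - covariance \<mu>) \<le> (norm x)\<^sup>2 + D"
      using norm_triangle_ineq4[of "outer x" "covariance \<mu>"] norm_covariance_le by (simp add: norm_outer)
    hence "norm (outer x - covariance \<mu>) ^ p \<le> ((norm x)\<^sup>2 + D) ^ p" by (intro power_mono) auto
    also have "\<dots> = 2 ^ p * (((1 - 1/2) * (norm x)\<^sup>2 + 1/2 * D) ^ p)"
      by (simp add: power_mult_distrib[symmetric])
    also have "\<dots> \<le> 2 ^ p * ((1 - 1/2) * ((norm x)\<^sup>2) ^ p + 1/2 * D ^ p)"
      by (intro mult_left_mono power_chord_le) (use D_pos in auto)
    finally show ?thesis by (simp add: algebra_simps)
  qed
  have "(\<integral>\<^sup>+x. ennreal (norm (outer x - covariance \<mu>) ^ p) \<partial>\<mu>)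
     \<le> (\<integral>\<^sup>+x. ennreal (2 ^ p / 2) * (ennreal (((norm x)\<^sup>2) ^ p) + ennreal (D ^ p)) \<partial>\<mu>)"
  proof (intro nn_integral_mono)
    fix x
    have "ennreal (norm (outer x - covariance \<mu>) ^ p) \<le> ennreal (2 ^ p / 2 * (((norm x)\<^sup>2) ^ p + D ^ p))"
      by (rule ennreal_leI[OF pw])
    also have "\<dots> = ennreal (2 ^ p / 2) * (ennreal (((norm x)\<^sup>2) ^ p) + ennreal (D ^ p))"
      using D_pos by (subst ennreal_mult) (auto simp: ennreal_plus)
    finally show "ennreal (norm (outer x - covariance \<mu>) ^ p)
      \<le> ennreal (2 ^ p / 2) * (ennreal (((norm x)\<^sup>2) ^ p) + ennreal (D ^ p))" .
  qed
  also have "\<dots> = ennreal (2 ^ p / 2) * ((\<integral>\<^sup>+x. ennreal (((norm x)\<^sup>2) ^ p) \<partial>\<mu>) + ennreal (D ^ p))"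
    by (simp add: nn_integral_add nn_integral_cmult emeasure_space_1)
  also have "\<dots> \<le> ennreal (2 ^ p / 2) * (ennreal (fact p * D ^ p) + ennreal (D ^ p))"
    using p by (intro mult_left_mono add_mono norm_moment) auto
  also have "\<dots> = ennreal (2 ^ p / 2 * ((fact p + 1) * D ^ p))"
    using D_pos by (subst ennreal_mult) (auto simp: ennreal_plus distrib_right)
  also have "\<dots> \<le> ennreal (fact p / 2 * (exp 1 * (real CARD('d) + 1) * K\<^sup>2) ^ p)"
  proof (intro ennreal_leI)
    \<comment> \<open>For p >= 2, fact p + 1 is at most 3/2 times fact p, so a gain of 3/2 from
      (e/2)^p suffices; 5/2 <= e already yields (5/4)^2 at p = 2.\<close>
    have e: "5 / 2 \<le> exp (1::real)" using exp_lower_Taylor_quadratic[of 1] by simp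
    have "3 / 2 \<le> (5 / 4 :: real)\<^sup>2" by (simp add: power2_eq_square)
    also have "\<dots> \<le> (exp 1 / 2)\<^sup>2" using e by (intro power_mono) auto
    also have "\<dots> \<le> (exp 1 / 2) ^ p" using e p by (intro power_increasing) auto
    finally have exp_p: "3 / 2 * 2 ^ p \<le> (exp 1 :: real) ^ p" by (simp add: power_divide field_simps)
    have "(2::real) \<le> fact p"
      using fact_mono[of 2 p, where 'a = real] p by (simp add: numeral_2_eq_2)
    hence "(fact p + 1) * 2 ^ p \<le> fact p * (3 / 2) * (2 ^ p :: real)" by (intro mult_right_mono) auto
    also have "\<dots> \<le> fact p * exp 1 ^ p"
      unfolding mult.assoc using exp_p by (intro mult_left_mono) auto
    finally have "(fact p + 1) * 2 ^ p \<le> (fact p * exp 1 ^ p :: real)" .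
    hence "2 ^ p / 2 * ((fact p + 1) * D ^ p) \<le> fact p / 2 * (exp 1 ^ p * D ^ p)"
      using mult_right_mono[of "(fact p + 1) * 2 ^ p" "fact p * exp 1 ^ p" "D ^ p / 2"] D_pos
      by (simp add: mult_ac)
    also have "\<dots> = fact p / 2 * (exp 1 * D) ^ p" by (simp add: power_mult_distrib)
    also have "\<dots> \<le> fact p / 2 * (exp 1 * (real CARD('d) + 1) * K\<^sup>2) ^ p"
      using D_pos by (intro mult_left_mono power_mono) (auto simp: D_eq algebra_simps)
    finally show "2 ^ p / 2 * ((fact p + 1) * D ^ p) \<le> fact p / 2 * (exp 1 * (real CARD('d) + 1) * K\<^sup>2) ^ p" .
  qed
  finally show ?thesis .
qed

lemma empirical_covariance_concentration:
  assumes g: "g > 0"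
  shows "measure (Pi\<^sub>M {..<n} (\<lambda>_. \<mu>)) {x \<in> space (Pi\<^sub>M {..<n} (\<lambda>_. \<mu>)).
       real n * (g / 4) \<le> norm (\<Sum>i<n. outer (x i) - covariance \<mu>)}
     \<le> 2 * exp (- pca_rate_const CARD('d) K g * real n)"
proof -
  define R where "R = exp 1 * (real CARD('d) + 1) * K\<^sup>2"
  have R: "R > 0" using K_pos by (simp add: R_def)
  have mean: "expectation (\<lambda>x. outer x - covariance \<mu>) = 0"
    using integrable_outer by (simp add: covariance_eq prob_space)
  \<comment> \<open>The Bernstein exponent at deviation g/4, which is where the constants 32 and 8
    of the rate originate.\<close>
  have "(g / 4)\<^sup>2 / (2 * (R\<^sup>2 + R * (g / 4))) = g\<^sup>2 / (32 * R\<^sup>2 + 8 * R * g)"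
    by (simp add: field_simps power2_eq_square)
  also have "\<dots> = pca_rate_const CARD('d) K g"
    by (simp add: pca_rate_const_def R_def power_mult_distrib mult_ac)
  finally have rate: "(g / 4)\<^sup>2 / (2 * (R\<^sup>2 + R * (g / 4))) = pca_rate_const CARD('d) K g" .
  have meas: "(\<lambda>x. outer x - covariance \<mu>) \<in> borel_measurable \<mu>" by measurable
  have "g / 4 > 0" using g by simp
  from bernstein_norm_sum[OF meas mean centered_outer_moment[folded R_def] R this, of n]
  show ?thesis by (simp only: rate)
qed

lemma sets_pair_law: "sets (\<mu> \<Otimes>\<^sub>M \<mu>) = sets borel"
  unfolding borel_prod[symmetric] by (rule sets_pair_measure_cong[OF sets_law sets_law])

lemma measurable_pca_pseudometric:
  "(\<lambda>(x, y). pca_pseudometric x y) \<in> borel_measurable (\<mu> \<Otimes>\<^sub>M \<mu>)"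
proof -
  have "(\<lambda>(x, y). pca_pseudometric x y) \<in> borel_measurable (borel \<Otimes>\<^sub>M (borel :: (real ^ 'd) measure))"
    unfolding pca_pseudometric_def of_bool_def by measurable
  thus ?thesis unfolding borel_prod using measurable_cong_sets[OF sets_pair_law refl] by blast
qed

text \<open>Dropping the indicator and dividing by 4 D leaves half-scale exponents in x and y, which
  factorise by independence; each factor contributes sqrt 2.\<close>

lemma pca_pseudometric_psi1_le: "pseudometric_psi1 \<mu> pca_pseudometric \<le> ennreal (4 * D)"
proof -
  let ?f = "\<lambda>x. ennreal (exp ((norm x)\<^sup>2 / (2 * D)))"
  have m: "?f \<in> borel_measurable \<mu>" by measurable
  have "exp (\<bar>pca_pseudometric x y\<bar> powr 1 / (4 * D) powr 1)
      \<le> exp ((norm x)\<^sup>2 / (2 * D)) * exp ((norm y)\<^sup>2 / (2 * D))" for x y :: "real ^ 'd"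
  proof -
    have "\<bar>pca_pseudometric x y\<bar> \<le> 2 * ((norm x)\<^sup>2 + (norm y)\<^sup>2)"
      by (simp add: pca_pseudometric_def)
    hence "\<bar>pca_pseudometric x y\<bar> / (4 * D) \<le> 2 * ((norm x)\<^sup>2 + (norm y)\<^sup>2) / (4 * D)"
      using D_pos by (intro divide_right_mono) auto
    also have "\<dots> = (norm x)\<^sup>2 / (2 * D) + (norm y)\<^sup>2 / (2 * D)" using D_pos by (simp add: field_simps)
    finally show ?thesis using D_pos by (simp add: exp_add[symmetric])
  qed
  hence "(\<integral>\<^sup>+\<omega>. ennreal (exp (\<bar>case_prod pca_pseudometric \<omega>\<bar> powr 1 / (4 * D) powr 1)) \<partial>(\<mu> \<Otimes>\<^sub>M \<mu>))
      \<le> (\<integral>\<^sup>+\<omega>. ?f (fst \<omega>) * ?f (snd \<omega>) \<partial>(\<mu> \<Otimes>\<^sub>M \<mu>))"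
    by (intro nn_integral_mono) (auto simp: ennreal_mult'[symmetric] intro!: ennreal_leI split: prod.splits)
  also have "\<dots> = (\<integral>\<^sup>+x. \<integral>\<^sup>+y. ?f x * ?f y \<partial>\<mu> \<partial>\<mu>)"
    by (subst nn_integral_fst[symmetric]) (auto intro!: borel_measurable_times_ennreal
        measurable_compose[OF measurable_fst m] measurable_compose[OF measurable_snd m])
  also have "\<dots> = (\<integral>\<^sup>+x. ?f x \<partial>\<mu>) * (\<integral>\<^sup>+x. ?f x \<partial>\<mu>)"
    using m by (simp add: nn_integral_cmult nn_integral_multc)
  also have "\<dots> \<le> ennreal (sqrt 2) * ennreal (sqrt 2)"
    by (intro mult_mono exp_half_moment_norm) auto
  also have "\<dots> = 2" by (simp add: ennreal_mult'[symmetric])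
  finally show ?thesis
    unfolding pseudometric_psi1_def psi_norm_def using D_pos
    by (intro Inf_lower) (auto intro!: exI[of _ "4 * D"])
qed

end

section \<open>Principal component analysis\<close>

lemma arccos_inner_bounds:
  assumes "norm x = 1" "norm y = 1"
  shows "0 \<le> arccos (x \<bullet> y)" "cos (arccos (x \<bullet> y)) = x \<bullet> y"
proof -
  have "\<bar>x \<bullet> y\<bar> \<le> 1" using Cauchy_Schwarz_ineq2[of x y] assms by simp
  thus "0 \<le> arccos (x \<bullet> y)" "cos (arccos (x \<bullet> y)) = x \<bullet> y"
    by (auto simp: abs_le_iff intro!: arccos_lbound cos_arccos)
qed

text \<open>By compactness the distance to the set of maximisers is attained, so the infimum can be
  traded for an actual maximiser.\<close>

lemma angle_to_rayleigh_argmax: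
  fixes A :: "real ^ 'd ^ 'd"
  assumes \<phi>: "norm \<phi> = 1"
  defines "d \<equiv> (INF \<psi>\<in>rayleigh_argmax A. arccos (\<phi> \<bullet> \<psi>))"
  obtains u where "u \<in> rayleigh_argmax A" "d = arccos (\<phi> \<bullet> u)"
    "\<And>\<psi>. \<psi> \<in> rayleigh_argmax A \<Longrightarrow> d \<le> arccos (\<phi> \<bullet> \<psi>)" "0 \<le> d"
proof -
  have nn: "0 \<le> arccos (\<phi> \<bullet> \<psi>)" if "\<psi> \<in> rayleigh_argmax A" for \<psi>
    using that \<phi> by (intro arccos_inner_bounds) (auto simp: rayleigh_argmax_def)
  have "- 1 \<le> \<phi> \<bullet> \<psi> \<and> \<phi> \<bullet> \<psi> \<le> 1" if "\<psi> \<in> rayleigh_argmax A" for \<psi>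
    using Cauchy_Schwarz_ineq2[of \<phi> \<psi>] \<phi> that by (auto simp: rayleigh_argmax_def)
  hence "continuous_on (rayleigh_argmax A) (\<lambda>\<psi>. arccos (\<phi> \<bullet> \<psi>))"
    by (intro continuous_intros) auto
  from continuous_attains_inf[OF compact_rayleigh_argmax rayleigh_argmax_nonempty this]
  obtain u where u: "u \<in> rayleigh_argmax A"
    "\<And>\<psi>. \<psi> \<in> rayleigh_argmax A \<Longrightarrow> arccos (\<phi> \<bullet> u) \<le> arccos (\<phi> \<bullet> \<psi>)" by blast
  have "d = arccos (\<phi> \<bullet> u)"
    unfolding d_def by (rule cInf_eq_minimum) (use u in auto)
  thus ?thesis using that u nn by auto
qed

text \<open>This replaces the ratio with its infimum by a condition on all maximisers, the form
  known to be open in the matrix. From right to left, the deficit is nonnegative and below k d^2, so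
  d cannot vanish.\<close>

lemma angle_ratio_less_iff:
  fixes A :: "real ^ 'd ^ 'd"
  assumes \<phi>: "norm \<phi> = 1" and v: "v \<in> rayleigh_argmax A" and k: "k \<ge> 0"
  defines "d \<equiv> (INF \<psi>\<in>rayleigh_argmax A. arccos (\<phi> \<bullet> \<psi>))"
  shows "d \<noteq> 0 \<and> (v \<bullet> (A *v v) - \<phi> \<bullet> (A *v \<phi>)) / d\<^sup>2 < k \<longleftrightarrow>
    (\<forall>\<psi>\<in>rayleigh_argmax A. \<psi> \<bullet> (A *v \<psi>) - \<phi> \<bullet> (A *v \<phi>) < k * (arccos (\<phi> \<bullet> \<psi>))\<^sup>2)"
    (is "?L \<longleftrightarrow> ?R")
proof -
  obtain u where u: "u \<in> rayleigh_argmax A" "d = arccos (\<phi> \<bullet> u)"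
    "\<And>\<psi>. \<psi> \<in> rayleigh_argmax A \<Longrightarrow> d \<le> arccos (\<phi> \<bullet> \<psi>)" "0 \<le> d"
    unfolding d_def by (rule angle_to_rayleigh_argmax[OF \<phi>, of A]) blast
  have same: "\<psi> \<bullet> (A *v \<psi>) = v \<bullet> (A *v v)" if "\<psi> \<in> rayleigh_argmax A" for \<psi>
    using that v by (force simp: rayleigh_argmax_def intro: antisym)
  have ge: "0 \<le> v \<bullet> (A *v v) - \<phi> \<bullet> (A *v \<phi>)" using v \<phi> by (auto simp: rayleigh_argmax_def)
  show ?thesis
  proof
    assume L: ?L
    show ?R
    proof
      fix \<psi> assume \<psi>: "\<psi> \<in> rayleigh_argmax A"
      have "v \<bullet> (A *v v) - \<phi> \<bullet> (A *v \<phi>) < k * d\<^sup>2"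
        using L pos_divide_less_eq[of "d\<^sup>2"] by simp
      also have "\<dots> \<le> k * (arccos (\<phi> \<bullet> \<psi>))\<^sup>2"
        using u(3)[OF \<psi>] u(4) k by (intro mult_left_mono power_mono) auto
      finally show "\<psi> \<bullet> (A *v \<psi>) - \<phi> \<bullet> (A *v \<phi>) < k * (arccos (\<phi> \<bullet> \<psi>))\<^sup>2"
        using same[OF \<psi>] by simp
    qed
  next
    assume ?R
    hence lt: "v \<bullet> (A *v v) - \<phi> \<bullet> (A *v \<phi>) < k * d\<^sup>2" using u(1,2) same[OF u(1)] by auto
    hence "d \<noteq> 0" using ge by auto
    thus ?L using lt by (simp add: pos_divide_less_eq)
  qed
qed

text \<open>Factor the difference of squares. For unit vectors at angle t the norms of the
  difference and the sum multiply to 2 sin t, which is at most 2 t.\<close>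

lemma inner_power2_diff_le:
  fixes \<phi> \<psi> x :: "'a::real_inner"
  assumes "norm \<phi> = 1" "norm \<psi> = 1"
  shows "\<bar>(\<phi> \<bullet> x)\<^sup>2 - (\<psi> \<bullet> x)\<^sup>2\<bar> \<le> 2 * arccos (\<phi> \<bullet> \<psi>) * (norm x)\<^sup>2"
proof -
  define t where "t = arccos (\<phi> \<bullet> \<psi>)"
  have t: "0 \<le> t" "cos t = \<phi> \<bullet> \<psi>" using arccos_inner_bounds[OF assms] by (auto simp: t_def)
  have n1: "\<phi> \<bullet> \<phi> = 1" "\<psi> \<bullet> \<psi> = 1" using assms by (auto simp: norm_eq_1)
  have "(norm (\<phi> - \<psi>) * norm (\<phi> + \<psi>))\<^sup>2 = (2 * sin t)\<^sup>2"
    unfolding power_mult_distrib power2_norm_eq_inner sin_squared_eq t(2)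
    by (simp add: inner_simps n1 inner_commute power2_eq_square algebra_simps)
  also have "\<dots> \<le> (2 * t)\<^sup>2"
    using abs_sin_x_le_abs_x[of t] by (simp add: abs_le_square_iff power_mult_distrib)
  finally have le: "norm (\<phi> - \<psi>) * norm (\<phi> + \<psi>) \<le> 2 * t"
    by (rule power2_le_imp_le) (use t(1) in simp)
  have "\<bar>(\<phi> \<bullet> x)\<^sup>2 - (\<psi> \<bullet> x)\<^sup>2\<bar> = \<bar>(\<phi> - \<psi>) \<bullet> x\<bar> * \<bar>(\<phi> + \<psi>) \<bullet> x\<bar>"
    by (simp add: abs_mult[symmetric] inner_simps power2_eq_square algebra_simps)
  also have "\<dots> \<le> (norm (\<phi> - \<psi>) * norm x) * (norm (\<phi> + \<psi>) * norm x)"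
    by (intro mult_mono Cauchy_Schwarz_ineq2) auto
  also have "\<dots> = (norm (\<phi> - \<psi>) * norm (\<phi> + \<psi>)) * (norm x)\<^sup>2" by (simp add: power2_eq_square)
  also have "\<dots> \<le> 2 * t * (norm x)\<^sup>2" using le by (intro mult_right_mono) auto
  finally show ?thesis by (simp add: t_def)
qed

lemma pseudometric_pca_pseudometric: "pseudometric pca_pseudometric"
  by (auto simp: pseudometric_def pca_pseudometric_def of_bool_def)

lemma pca_loss_regularity:
  assumes "norm \<phi> = 1" "norm \<psi> = 1"
  shows "- (\<phi> \<bullet> x)\<^sup>2 - - (\<psi> \<bullet> x)\<^sup>2 - - (\<phi> \<bullet> y)\<^sup>2 + - (\<psi> \<bullet> y)\<^sup>2
           \<le> pca_pseudometric x y * arccos (\<phi> \<bullet> \<psi>) powr 1"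
proof (cases "x = y")
  case False
  have "- (\<phi> \<bullet> x)\<^sup>2 - - (\<psi> \<bullet> x)\<^sup>2 - - (\<phi> \<bullet> y)\<^sup>2 + - (\<psi> \<bullet> y)\<^sup>2
      \<le> \<bar>(\<phi> \<bullet> x)\<^sup>2 - (\<psi> \<bullet> x)\<^sup>2\<bar> + \<bar>(\<phi> \<bullet> y)\<^sup>2 - (\<psi> \<bullet> y)\<^sup>2\<bar>" by linarith
  also have "\<dots> \<le> 2 * arccos (\<phi> \<bullet> \<psi>) * (norm x)\<^sup>2 + 2 * arccos (\<phi> \<bullet> \<psi>) * (norm y)\<^sup>2"
    by (intro add_mono inner_power2_diff_le assms)
  also have "\<dots> = pca_pseudometric x y * arccos (\<phi> \<bullet> \<psi>) powr 1"
    using False arccos_inner_bounds(1)[OF assms] by (simp add: pca_pseudometric_def algebra_simps)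
  finally show ?thesis .
qed (simp add: pca_pseudometric_def)

text \<open>For n = 0 this is the zero matrix by the convention on division, in agreement with the
  empirical risk of the empty sample.\<close>

definition empirical_covariance :: "nat \<Rightarrow> (nat \<Rightarrow> real ^ 'd) \<Rightarrow> real ^ 'd ^ 'd" where
  "empirical_covariance n x = (1 / real n) *\<^sub>R (\<Sum>i<n. outer (x i))"

lemma transpose_empirical_covariance: "transpose (empirical_covariance n x) = empirical_covariance n x"
  by (simp add: empirical_covariance_def transpose_def vec_eq_iff outer_def mult.commute)

lemma emp_risk_pca:
  "emp_risk (pca_problem \<mu>) n x \<phi> = ereal (- (\<phi> \<bullet> (empirical_covariance n x *v \<phi>)))"
  by (simp add: emp_risk_def pca_problem_def inner_outer[symmetric] empirical_covariance_def
      inner_sum_left inner_outer_outer inner_commute[of \<phi>] sum_negf)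

lemma emp_sols_pca: "emp_sols (pca_problem \<mu>) n x = rayleigh_argmax (empirical_covariance n x)"
  unfolding emp_sols_def argmin_on_def emp_risk_pca
  by (auto simp: pca_problem_def rayleigh_argmax_def)

lemma emp_min_risk_pca:
  assumes "v \<in> rayleigh_argmax (empirical_covariance n x)"
  shows "emp_min_risk (pca_problem \<mu>) n x = ereal (- (v \<bullet> (empirical_covariance n x *v v)))"
  unfolding emp_min_risk_def emp_risk_pca
  by (rule INF_eqI) (use assms in \<open>auto simp: pca_problem_def rayleigh_argmax_def\<close>)

lemma metr_to_set_pca: "metr_to_set (pca_problem \<mu>) \<phi> E = (INF \<psi>\<in>E. arccos (\<phi> \<bullet> \<psi>))"
  by (simp add: metr_to_set_def pca_problem_def)

text \<open>Being strictly below an infimum is an existential statement. The candidates \<phi> range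
  over a set that does not depend on x, and for each of them the condition depends on x only through
  its empirical covariance.\<close>

lemma tau_hat_pca_less_iff:
  assumes k: "k \<ge> 0"
  shows "tau_hat (pca_problem \<mu>) \<infinity> 2 n x < ereal k \<longleftrightarrow>
    (\<exists>\<phi>\<in>(\<Union>y\<in>{..<n} \<rightarrow>\<^sub>E measure_support \<mu>. rayleigh_argmax (empirical_covariance n y)).
       \<forall>\<psi>\<in>rayleigh_argmax (empirical_covariance n x).
         \<psi> \<bullet> (empirical_covariance n x *v \<psi>) - \<phi> \<bullet> (empirical_covariance n x *v \<phi>)
           < k * (arccos (\<phi> \<bullet> \<psi>))\<^sup>2)"
proof -
  let ?A = "empirical_covariance n x"
  let ?d = "\<lambda>\<phi>. INF \<psi>\<in>rayleigh_argmax ?A. arccos (\<phi> \<bullet> \<psi>)"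
  obtain v where v: "v \<in> rayleigh_argmax ?A" using rayleigh_argmax_nonempty by blast
  have ratio: "?d \<phi> \<noteq> 0 \<and> (emp_risk (pca_problem \<mu>) n x \<phi> - emp_min_risk (pca_problem \<mu>) n x) /
        ereal (?d \<phi> powr 2) < ereal k \<longleftrightarrow>
      (\<forall>\<psi>\<in>rayleigh_argmax ?A. \<psi> \<bullet> (?A *v \<psi>) - \<phi> \<bullet> (?A *v \<phi>) < k * (arccos (\<phi> \<bullet> \<psi>))\<^sup>2)"
    if \<phi>: "norm \<phi> = 1" for \<phi>
  proof -
    have d0: "0 \<le> ?d \<phi>" by (rule angle_to_rayleigh_argmax[OF \<phi>, of ?A])
    have "(emp_risk (pca_problem \<mu>) n x \<phi> - emp_min_risk (pca_problem \<mu>) n x) / ereal (?d \<phi> powr 2)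
        = ereal ((v \<bullet> (?A *v v) - \<phi> \<bullet> (?A *v \<phi>)) / (?d \<phi>)\<^sup>2)" if "?d \<phi> \<noteq> 0"
      using that d0 by (simp add: emp_risk_pca emp_min_risk_pca[OF v] divide_ereal_def divide_inverse)
    thus ?thesis unfolding angle_ratio_less_iff[OF \<phi> v k, symmetric] by auto
  qed
  have law: "law (pca_problem \<mu>) = \<mu>" "hyps (pca_problem \<mu>) = sphere 0 1" by (simp_all add: pca_problem_def)
  have "tau_hat (pca_problem \<mu>) \<infinity> 2 n x < ereal k \<longleftrightarrow>
     (\<exists>y\<in>{..<n} \<rightarrow>\<^sub>E measure_support \<mu>. \<exists>\<phi>\<in>rayleigh_argmax (empirical_covariance n y). ?d \<phi> \<noteq> 0 \<and>
        (emp_risk (pca_problem \<mu>) n x \<phi> - emp_min_risk (pca_problem \<mu>) n x) / ereal (?d \<phi> powr 2) < ereal k)"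
    unfolding tau_hat_def INF_less_iff law emp_sols_pca metr_to_set_pca
    by (force simp: rayleigh_argmax_def)
  also have "\<dots> \<longleftrightarrow> (\<exists>y\<in>{..<n} \<rightarrow>\<^sub>E measure_support \<mu>. \<exists>\<phi>\<in>rayleigh_argmax (empirical_covariance n y).
      \<forall>\<psi>\<in>rayleigh_argmax ?A. \<psi> \<bullet> (?A *v \<psi>) - \<phi> \<bullet> (?A *v \<phi>) < k * (arccos (\<phi> \<bullet> \<psi>))\<^sup>2)"
    by (intro bex_cong refl ratio) (simp add: rayleigh_argmax_def)
  finally show ?thesis by blast
qed

text \<open>For the zero matrix the top eigenvalue is 0, while a nonzero vector orthogonal to v,
  which exists as d >= 2, forces lam 2 to be nonnegative. This rules out a vanishing subgaussian
  norm.\<close>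

lemma covariance_nonzero:
  fixes \<mu> :: "(real ^ 'd) measure"
  assumes dim: "CARD('d) \<ge> 2" and ev: "ordered_eigenvalues (covariance \<mu>) lam" and gap: "lam 1 > lam 2"
  shows "covariance \<mu> \<noteq> 0"
proof
  assume 0: "covariance \<mu> = 0"
  hence "transpose (covariance \<mu>) = covariance \<mu>" by (simp add: transpose_def vec_eq_iff)
  from spectral_gap[OF this ev gap dim] obtain v where v: "norm v = 1" "covariance \<mu> *v v = lam 1 *\<^sub>R v"
    "\<And>w. v \<bullet> w = 0 \<Longrightarrow> w \<bullet> (covariance \<mu> *v w) \<le> lam 2 * (norm w)\<^sup>2" by blast
  obtain w where w: "w \<noteq> 0" "orthogonal v w" using orthogonal_to_vector_exists[of v] dim by auto
  have "v \<noteq> 0" using v(1) by auto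
  hence "lam 1 = 0" using v(2) 0 by simp
  moreover have "0 \<le> lam 2 * (norm w)\<^sup>2" using v(3)[of w] w 0 by (simp add: orthogonal_def)
  hence "0 \<le> lam 2" using w(1) by (simp add: zero_le_mult_iff)
  ultimately show False using gap by simp
qed

lemma vec_psi2_norm_eq_0_imp_covariance_0:
  fixes \<mu> :: "(real ^ 'd) measure"
  assumes prob: "prob_space \<mu>" and borel: "sets \<mu> = sets borel" and 0: "vec_psi2_norm \<mu> = 0"
  shows "covariance \<mu> = 0"
proof -
  have ae: "AE x in \<mu>. x $ i = 0" for i
  proof -
    have "psi_norm 2 \<mu> (\<lambda>x. x \<bullet> axis i 1) \<le> vec_psi2_norm \<mu>"
      unfolding vec_psi2_norm_def by (intro SUP_upper) simp
    hence "psi_norm 2 \<mu> (\<lambda>x. x \<bullet> axis i 1) = 0" using 0 by simp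
    moreover have "(\<lambda>x. x \<bullet> axis i 1) \<in> borel_measurable \<mu>"
      by (subst measurable_cong_sets[OF borel refl]) measurable
    ultimately show ?thesis using psi_norm_2_eq_0_imp[OF _ prob] by (simp add: inner_axis)
  qed
  have "(\<integral>x. x $ i * x $ j \<partial>\<mu>) = 0" for i j
    by (rule integral_eq_zero_AE) (use ae[of i] in auto)
  thus ?thesis by (simp add: covariance_def vec_eq_iff)
qed

section \<open>Verification of the assumptions for principal components\<close>

context subgaussian_law
begin

text \<open>The loss is nonpositive, so the first integral in \<open>expect\<close> is 0 and the
  second is the finite second moment.\<close>

lemma risk_pca: "risk (pca_problem \<mu>) \<phi> = ereal (- (\<phi> \<bullet> (covariance \<mu> *v \<phi>)))"
proof -
  have "0 \<le> \<phi> \<bullet> (covariance \<mu> *v \<phi>)" by (simp add: rayleigh_covariance)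
  thus ?thesis
    by (simp add: risk_def expect_def pca_problem_def nn_integral_inner_power2 ennreal_neg zero_ereal_def zero_ennreal.rep_eq)
qed

lemma sols_pca: "sols (pca_problem \<mu>) = rayleigh_argmax (covariance \<mu>)"
  unfolding sols_def argmin_on_def risk_pca by (auto simp: pca_problem_def rayleigh_argmax_def)

lemma min_risk_pca:
  assumes "v \<in> rayleigh_argmax (covariance \<mu>)"
  shows "min_risk (pca_problem \<mu>) = ereal (- (v \<bullet> (covariance \<mu> *v v)))"
  unfolding min_risk_def risk_pca
  by (rule INF_eqI) (use assms in \<open>auto simp: pca_problem_def rayleigh_argmax_def\<close>)

lemma measurable_outer_component:
  assumes "i < n"
  shows "(\<lambda>x. outer (x i)) \<in> borel_measurable (Pi\<^sub>M {..<n} (\<lambda>_. \<mu>))"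
proof (rule measurable_compose[OF measurable_component_singleton])
  show "outer \<in> borel_measurable \<mu>" by measurable
qed (use assms in simp)

lemma measurable_empirical_covariance:
  "empirical_covariance n \<in> borel_measurable (Pi\<^sub>M {..<n} (\<lambda>_. \<mu>))"
  unfolding empirical_covariance_def[abs_def]
  by (intro borel_measurable_scaleR borel_measurable_const borel_measurable_sum
      measurable_outer_component) auto

lemma minimizers_exist_pca: "minimizers_exist (pca_problem \<mu>)"
proof -
  obtain f :: "real ^ 'd ^ 'd \<Rightarrow> real ^ 'd"
    where f: "f \<in> borel_measurable borel" "\<And>A. f A \<in> rayleigh_argmax A"
    using measurable_leading_eigenvector by blast
  have "hyps (pca_problem \<mu>) \<noteq> {}" by (simp add: pca_problem_def)
  hence proper: "proper_on (hyps (pca_problem \<mu>)) (risk (pca_problem \<mu>))"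
    "proper_on (hyps (pca_problem \<mu>)) (emp_risk (pca_problem \<mu>) n x)" for n x
    unfolding proper_on_def risk_pca emp_risk_pca by auto
  have "(\<lambda>x. f (empirical_covariance n x)) \<in> borel_measurable (sample (pca_problem \<mu>) n)" for n
    using measurable_compose[OF measurable_empirical_covariance f(1)]
    by (simp add: sample_def pca_problem_def)
  thus ?thesis
    unfolding minimizers_exist_def sols_pca emp_sols_pca
    using proper rayleigh_argmax_nonempty f(2) by (auto intro!: bexI[of _ "\<lambda>x. f (empirical_covariance _ x)"])
qed

text \<open>The regularity bound holds on the whole sphere, which is taken as the set containing the
  solutions, so the exceptional event is empty.\<close>

lemma loss_regularity_pca: "loss_regularity (pca_problem \<mu>) 1 pca_pseudometric (\<lambda>n. 0)"
proof -
  let ?P = "pca_problem \<mu>"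
  have law: "law ?P = \<mu>" by (simp add: pca_problem_def)
  have "pseudometric_psi1 \<mu> pca_pseudometric < \<infinity>"
    using pca_pseudometric_psi1_le by (rule le_less_trans) simp
  moreover have "sols ?P \<subseteq> hyps ?P" by (auto simp: sols_def argmin_on_def)
  moreover have "AE (x, y) in \<mu> \<Otimes>\<^sub>M \<mu>.
        loss ?P \<phi> x - loss ?P \<psi> x - loss ?P \<phi> y + loss ?P \<psi> y \<le> pca_pseudometric x y * metr ?P \<phi> \<psi> powr 1"
    if "\<phi> \<in> hyps ?P" "\<psi> \<in> hyps ?P" for \<phi> \<psi>
    using pca_loss_regularity[of \<phi> \<psi>] that by (intro AE_I2) (auto simp: pca_problem_def)
  moreover have "prob_le (sample ?P n) (\<lambda>x. \<not> emp_sols ?P n x \<subseteq> hyps ?P) 0" for n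
  proof -
    have "{x \<in> space (sample ?P n). \<not> emp_sols ?P n x \<subseteq> hyps ?P} = {}"
      by (auto simp: emp_sols_def argmin_on_def)
    thus ?thesis unfolding prob_le_def by (simp only:) simp
  qed
  ultimately show ?thesis
    unfolding loss_regularity_def law
    using pseudometric_pca_pseudometric measurable_pca_pseudometric
    by (auto simp: vanishing_rate_def intro!: exI[of _ "hyps ?P"])
qed

lemma emp_sols_in_sublevel_pca: "emp_sols_in_sublevel (pca_problem \<mu>) \<infinity> (\<lambda>n. 0)"
  by (simp add: emp_sols_in_sublevel_def vanishing_rate_def prob_le_def)

lemma growth_condition_pca:
  assumes v: "norm v = 1" "covariance \<mu> *v v = l1 *\<^sub>R v"
    and gap: "\<And>w. v \<bullet> w = 0 \<Longrightarrow> w \<bullet> (covariance \<mu> *v w) \<le> l2 * (norm w)\<^sup>2" and l: "l1 > l2"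
  shows "growth_condition (pca_problem \<mu>) \<infinity> 2 (4 / pi\<^sup>2 * (l1 - l2))"
proof -
  let ?A = "covariance \<mu>"
  have vv: "v \<bullet> (?A *v v) = l1" using v by (simp add: norm_eq_1)
  have v_max: "v \<in> rayleigh_argmax ?A"
    using l by (intro eigenvector_in_rayleigh_argmax[OF transpose_covariance v gap]) simp_all
  have "ereal (4 / pi\<^sup>2 * (l1 - l2) * (INF \<psi>\<in>rayleigh_argmax ?A. arccos (\<phi> \<bullet> \<psi>)) powr 2)
      \<le> ereal (- (\<phi> \<bullet> (?A *v \<phi>))) - ereal (- (v \<bullet> (?A *v v)))" if \<phi>: "norm \<phi> = 1" for \<phi>
  proof -
    have "0 \<le> (INF \<psi>\<in>rayleigh_argmax ?A. arccos (\<phi> \<bullet> \<psi>))"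
      by (rule angle_to_rayleigh_argmax[OF \<phi>, of ?A])
    moreover have "4 / pi\<^sup>2 * (l1 - l2) * (INF \<psi>\<in>rayleigh_argmax ?A. arccos (\<phi> \<bullet> \<psi>))\<^sup>2
        \<le> v \<bullet> (?A *v v) - \<phi> \<bullet> (?A *v \<phi>)"
    proof (rule rayleigh_quadratic_growth[OF transpose_covariance v_max _ _ \<phi>])
      fix w :: "real ^ 'd" assume "norm w = 1" "v \<bullet> w = 0"
      thus "w \<bullet> (?A *v w) \<le> v \<bullet> (?A *v v) - (l1 - l2)" using gap[of w] vv by simp
    qed (use l in simp)
    ultimately show ?thesis by simp
  qed
  thus ?thesis
    using l unfolding growth_condition_def sols_pca metr_to_set_pca risk_pca min_risk_pca[OF v_max]
    by (auto simp: pca_problem_def)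
qed

text \<open>If the empirical covariance is within a quarter of the gap of the true one, half the gap
  survives and quadratic growth holds with half the constant for every unit \<phi> at once, hence
  for all candidates from all samples y. The failure event thus lies in the concentration
  event.\<close>

lemma emp_growth_condition_pca:
  assumes v: "norm v = 1" "covariance \<mu> *v v = l1 *\<^sub>R v"
    and gap: "\<And>w. v \<bullet> w = 0 \<Longrightarrow> w \<bullet> (covariance \<mu> *v w) \<le> l2 * (norm w)\<^sup>2" and l: "l1 > l2"
  shows "emp_growth_condition (pca_problem \<mu>) \<infinity> 2 (4 / pi\<^sup>2 * (l1 - l2))
     (\<lambda>n. min 1 (2 * real CARD('d) * exp (- pca_rate_const CARD('d) K (l1 - l2) * real n)))"
proof -
  let ?c = "pca_rate_const CARD('d) K (l1 - l2)"
  let ?\<kappa> = "\<lambda>n. min 1 (2 * real CARD('d) * exp (- ?c * real n))"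
  let ?t = "4 / pi\<^sup>2 * (l1 - l2) / 2"
  have vv: "v \<bullet> (covariance \<mu> *v v) = l1" using v by (simp add: norm_eq_1)
  have c: "?c > 0"
    using l K_pos unfolding pca_rate_const_def by (intro divide_pos_pos add_pos_pos mult_pos_pos) auto
  have t: "?t \<ge> 0" using l by simp
  have vanish: "vanishing_rate ?\<kappa>"
  proof -
    have "(\<lambda>n. exp (- ?c) ^ n) \<longlonglongrightarrow> 0" using c by (intro LIMSEQ_power_zero) simp
    moreover have "exp (- ?c) ^ n = exp (- ?c * real n)" for n
      by (simp add: exp_of_nat_mult[symmetric] mult.commute)
    ultimately have "(\<lambda>n. exp (- ?c * real n)) \<longlonglongrightarrow> 0" by (simp only:)
    from tendsto_min[OF tendsto_const[of 1] tendsto_mult_left[OF this, of "2 * real CARD('d)"]]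
    have "?\<kappa> \<longlonglongrightarrow> 0" by simp
    thus ?thesis by (auto simp: vanishing_rate_def)
  qed
  have "prob_le (sample (pca_problem \<mu>) n)
      (\<lambda>x. tau_hat (pca_problem \<mu>) \<infinity> 2 n x < ereal ?t) (?\<kappa> n)" if n: "n \<ge> 1" for n
  proof -
    let ?S = "Pi\<^sub>M {..<n} (\<lambda>_. \<mu>)"
    interpret S: prob_space ?S by (intro prob_space_PiM prob_space_axioms)
    let ?E = "{x \<in> space ?S. tau_hat (pca_problem \<mu>) \<infinity> 2 n x < ereal ?t}"
    let ?F = "{x \<in> space ?S. real n * ((l1 - l2) / 4) \<le> norm (\<Sum>i<n. outer (x i) - covariance \<mu>)}"
    define \<Phi> where "\<Phi> = (\<Union>y\<in>{..<n} \<rightarrow>\<^sub>E measure_support \<mu>. rayleigh_argmax (empirical_covariance n y))"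
    have \<Phi>: "norm \<phi> = 1" if "\<phi> \<in> \<Phi>" for \<phi> using that by (auto simp: \<Phi>_def rayleigh_argmax_def)
    let ?U = "\<lambda>\<phi>. {A :: real ^ 'd ^ 'd. \<forall>\<psi>\<in>rayleigh_argmax A. \<psi> \<bullet> (A *v \<psi>) - \<phi> \<bullet> (A *v \<phi>) < ?t * (arccos (\<phi> \<bullet> \<psi>))\<^sup>2}"
    have E: "?E = empirical_covariance n -` (\<Union>\<phi>\<in>\<Phi>. ?U \<phi>) \<inter> space ?S"
      unfolding tau_hat_pca_less_iff[OF t] \<Phi>_def[symmetric] by auto
    \<comment> \<open>Openness handles a possibly uncountable union over the candidates, where
      measurability of each member would not suffice.\<close>
    have "open (\<Union>\<phi>\<in>\<Phi>. ?U \<phi>)"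
      by (intro open_UN ballI open_rayleigh_gap_below_angle \<Phi>)
    hence meas: "?E \<in> sets ?S"
      unfolding E by (intro measurable_sets[OF measurable_empirical_covariance] borel_open)
    have sub: "?E \<subseteq> ?F"
    proof
      fix x assume x: "x \<in> ?E"
      let ?A = "empirical_covariance n x"
      obtain \<phi> where "\<phi> \<in> \<Phi>" and \<phi>: "?A \<in> ?U \<phi>" using x unfolding E by blast
      hence n\<phi>: "norm \<phi> = 1" using \<Phi> by blast
      have far: "(l1 - l2) / 4 \<le> norm (?A - covariance \<mu>)"
      proof (rule ccontr)
        assume "\<not> ?thesis"
        hence near: "norm (?A - covariance \<mu>) \<le> (l1 - l2) / 4" by simp
        obtain u where u: "u \<in> rayleigh_argmax ?A" using rayleigh_argmax_nonempty by blast
        have "4 / pi\<^sup>2 * ((l1 - l2) / 2) * (INF \<psi>\<in>rayleigh_argmax ?A. arccos (\<phi> \<bullet> \<psi>))\<^sup>2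
            \<le> u \<bullet> (?A *v u) - \<phi> \<bullet> (?A *v \<phi>)"
        proof (rule rayleigh_quadratic_growth[OF transpose_empirical_covariance u _ _ n\<phi>])
          fix w :: "real ^ 'd" assume "norm w = 1" "u \<bullet> w = 0"
          from perturbed_spectral_gap[OF transpose_empirical_covariance near v(1) vv gap u this]
          show "w \<bullet> (?A *v w) \<le> u \<bullet> (?A *v u) - (l1 - l2) / 2" by (simp add: field_simps)
        qed (use l in simp)
        moreover have "(INF \<psi>\<in>rayleigh_argmax ?A. arccos (\<phi> \<bullet> \<psi>)) \<noteq> 0 \<and>
            (u \<bullet> (?A *v u) - \<phi> \<bullet> (?A *v \<phi>)) / (INF \<psi>\<in>rayleigh_argmax ?A. arccos (\<phi> \<bullet> \<psi>))\<^sup>2 < ?t"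
          unfolding angle_ratio_less_iff[OF n\<phi> u t] using \<phi> by blast
        ultimately show False by (auto simp: divide_less_eq)
      qed
      have sum_eq: "(\<Sum>i<n. outer (x i) - covariance \<mu>) = real n *\<^sub>R (?A - covariance \<mu>)"
        using n by (simp add: empirical_covariance_def sum_subtractf scaleR_diff_right sum_constant_scaleR
            del: sum_constant)
      have "real n * ((l1 - l2) / 4) \<le> real n * norm (?A - covariance \<mu>)"
        by (intro mult_left_mono far) simp
      also have "\<dots> = norm (\<Sum>i<n. outer (x i) - covariance \<mu>)" by (simp add: sum_eq)
      finally show "x \<in> ?F" using x by blast
    qed
    have "?F \<in> sets ?S"
    proof -
      have "(\<lambda>x. norm (\<Sum>i<n. outer (x i) - covariance \<mu>)) \<in> borel_measurable ?S"
        by (intro measurable_compose[OF _ borel_measurable_norm] borel_measurable_sum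
            borel_measurable_diff borel_measurable_const measurable_outer_component) auto
      thus ?thesis by measurable
    qed
    hence "measure ?S ?E \<le> measure ?S ?F" by (intro S.finite_measure_mono sub)
    also have "\<dots> \<le> 2 * exp (- ?c * real n)"
      using l by (intro empirical_covariance_concentration) simp
    \<comment> \<open>The dimension-free bound is weakened to the stated prefactor; the cap at 1
      comes from the product law being a probability.\<close>
    also have "\<dots> \<le> 2 * real CARD('d) * exp (- ?c * real n)"
      by (intro mult_right_mono) (auto simp: Suc_le_eq)
    finally have "measure ?S ?E \<le> ?\<kappa> n" by simp
    thus ?thesis using meas by (simp add: prob_le_def sample_def pca_problem_def)
  qed
  thus ?thesis using vanish by (simp add: emp_growth_condition_def)
qed

end

theorem lemma20:
  fixes \<mu> :: "(real ^ 'd) measure" and lam :: "nat \<Rightarrow> real"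
  assumes dim: "CARD('d) \<ge> 2"
    and prob: "prob_space \<mu>"
    and borel: "sets \<mu> = sets borel"
    and centered: "(\<integral>x. x \<partial>\<mu>) = 0"
    and psi2: "vec_psi2_norm \<mu> < \<infinity>"
    and eigenvalues: "ordered_eigenvalues (covariance \<mu>) lam"
    and gap: "lam 1 > lam 2"
  shows "let P = pca_problem \<mu>;
             d = CARD('d);
             c = pca_rate_const d (enn2real (vec_psi2_norm \<mu>)) (lam 1 - lam 2);
             J0 = \<infinity>;
             \<beta> = 2;
             \<tau> = 4 / pi\<^sup>2 * (lam 1 - lam 2);
             \<alpha> = 1;
             \<eta> = (\<lambda>n. 0);
             \<kappa> = (\<lambda>n. min 1 (2 * real d * exp (- c * real n)));
             \<iota> = (\<lambda>n. 0);
             a = pca_pseudometric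
         in minimizers_exist P \<and>
            growth_condition P J0 \<beta> \<tau> \<and>
            emp_sols_in_sublevel P J0 \<eta> \<and>
            emp_growth_condition P J0 \<beta> \<tau> \<kappa> \<and>
            loss_regularity P \<alpha> a \<iota> \<and>
            pseudometric_psi1 \<mu> a \<le> 4 * of_nat d * (vec_psi2_norm \<mu>)\<^sup>2"
proof -
  define K where "K = enn2real (vec_psi2_norm \<mu>)"
  have norm_K: "vec_psi2_norm \<mu> = ennreal K"
    using psi2 by (simp add: K_def)
  \<comment> \<open>A zero norm would make every coordinate vanish almost surely and with it the
    covariance, contradicting the gap.\<close>
  have "vec_psi2_norm \<mu> \<noteq> 0"
    using vec_psi2_norm_eq_0_imp_covariance_0[OF prob borel] covariance_nonzero[OF dim eigenvalues gap] by blast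
  hence K: "K > 0" using norm_K by (metis K_def enn2real_nonneg ennreal_0 less_eq_real_def)
  interpret subgaussian_law \<mu> K "real CARD('d) * K\<^sup>2"
  proof (intro subgaussian_law.intro subgaussian_law_axioms.intro prob borel K refl)
    fix v :: "real ^ 'd" assume "norm v = 1"
    hence "psi_norm 2 \<mu> (\<lambda>x. x \<bullet> v) \<le> ennreal K"
      unfolding norm_K[symmetric] vec_psi2_norm_def by (intro SUP_upper) simp
    moreover have "(\<lambda>x. x \<bullet> v) \<in> borel_measurable \<mu>"
      by (subst measurable_cong_sets[OF borel refl]) measurable
    ultimately show "(\<integral>\<^sup>+x. ennreal (exp ((x \<bullet> v)\<^sup>2 / K\<^sup>2)) \<partial>\<mu>) \<le> 2"
      using K by (intro psi_norm_2_admissible)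
  qed
  obtain v where v: "norm v = 1" "covariance \<mu> *v v = lam 1 *\<^sub>R v"
    "\<And>w. v \<bullet> w = 0 \<Longrightarrow> w \<bullet> (covariance \<mu> *v w) \<le> lam 2 * (norm w)\<^sup>2"
    using spectral_gap[OF transpose_covariance eigenvalues gap dim] by blast
  have "4 * of_nat CARD('d) * (vec_psi2_norm \<mu>)\<^sup>2 = ennreal (4 * (real CARD('d) * K\<^sup>2))"
    using K by (simp add: norm_K ennreal_mult' ennreal_power ennreal_of_nat_eq_real_of_nat mult.assoc)
  hence "pseudometric_psi1 \<mu> pca_pseudometric \<le> 4 * of_nat CARD('d) * (vec_psi2_norm \<mu>)\<^sup>2"
    using pca_pseudometric_psi1_le by simp
  thus ?thesis
    unfolding Let_def K_def[symmetric]
    by (intro conjI minimizers_exist_pca loss_regularity_pca emp_sols_in_sublevel_pca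
        growth_condition_pca[OF v gap] emp_growth_condition_pca[OF v gap])
qed

end
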